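(* Let $G$ be a finite noncyclic nilpotent group whose order is divisible by exactly $k$ distinct primes, and suppose $G\in\mathcal{D}_n$. Then $G$ has nilpotency class at most $(n+2-2^k)/2^k$, and the derived length of $G$ is at most $\log_2\big((n+2-2^k)/2^k\big)+1$.
   Context: $\mathcal{D}(G)$ denotes the number of conjugacy classes of nontrivial subgroups $H$ of the finite group $G$ with $N_G(H)\neq H$; $\mathcal{D}_n$ is the family of finite groups $G$ with $\mathcal{D}(G)=n$. *)

theory Defs
  imports "HOL-Algebra.Algebra" "HOL-Computational_Algebra.Primes" Complex_Main
begin

definition commutator_subgroup :: "('a, 'b) monoid_scheme \<Rightarrow> 'a set \<Rightarrow> 'a set \<Rightarrow> 'a set" where
  "commutator_subgroup G A B = generate G
     (\<Union>a\<in>A. \<Union>b\<in>B. {a \<otimes>\<^bsub>G\<^esub> b \<otimes>\<^bsub>G\<^esub> inv\<^bsub>G\<^esub> a \<otimes>\<^bsub>G\<^esub> inv\<^bsub>G\<^esub> b})"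

text \<open>Lower central series: lower_central G i is gamma_(i+1)(G); gamma_1 = G, gamma_(i+1) = [gamma_i, G].\<close>
fun lower_central :: "('a, 'b) monoid_scheme \<Rightarrow> nat \<Rightarrow> 'a set" where
  "lower_central G 0 = carrier G"
| "lower_central G (Suc i) = commutator_subgroup G (lower_central G i) (carrier G)"

definition nilpotent_group :: "('a, 'b) monoid_scheme \<Rightarrow> bool" where
  "nilpotent_group G \<longleftrightarrow> group G \<and> (\<exists>c. lower_central G c = {\<one>\<^bsub>G\<^esub>})"

definition nilpotency_class :: "('a, 'b) monoid_scheme \<Rightarrow> nat" where
  "nilpotency_class G = (LEAST c. lower_central G c = {\<one>\<^bsub>G\<^esub>})"

definition derived_length :: "('a, 'b) monoid_scheme \<Rightarrow> nat" where
  "derived_length G = (LEAST d. (derived G ^^ d) (carrier G) = {\<one>\<^bsub>G\<^esub>})"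

definition subgroup_conj_class :: "('a, 'b) monoid_scheme \<Rightarrow> 'a set \<Rightarrow> 'a set set" where
  "subgroup_conj_class G H = {g <#\<^bsub>G\<^esub> H #>\<^bsub>G\<^esub> inv\<^bsub>G\<^esub> g | g. g \<in> carrier G}"

definition D_count :: "('a, 'b) monoid_scheme \<Rightarrow> nat" where
  "D_count G = card {subgroup_conj_class G H | H.
      subgroup H G \<and> H \<noteq> {\<one>\<^bsub>G\<^esub>} \<and> normalizer G H \<noteq> H}"

end

theory Submission
  imports Defs
begin

text \<open>
  In a nilpotent group every proper subgroup is smaller than its normalizer, so \<open>n + 2\<close> is the
  number of conjugacy classes of all subgroups. \<open>G\<close> is the direct product of its Sylow subgroups,
  hence multiplying subgroups of one Sylow subgroup \<open>P\<close> of order \<open>p\<^sup>a\<close> by Hall subgroups for the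
  \<open>2\<^bsup>k-1\<^esup>\<close> sets of other primes yields \<open>2\<^bsup>k-1\<^esup>\<close> times as many classes as \<open>P\<close> has.
  A noncyclic \<open>P\<close> has at least \<open>2a\<close> of them: at least two subgroups of each order \<open>p\<^sup>i\<close> with
  \<open>2 \<le> i < a\<close>, one of which is normal, at least three maximal subgroups, and one subgroup each of
  order \<open>1\<close>, \<open>p\<close> and \<open>p\<^sup>a\<close>. So \<open>n + 2 \<ge> 2\<^sup>k a\<close>. A noncyclic \<open>P\<close> has class less than \<open>a\<close>, because its
  derived subgroup has index at least \<open>p\<^sup>2\<close>, and some noncyclic Sylow subgroup has the class of \<open>G\<close>,
  or \<open>G\<close> has class \<open>1\<close>.
  The bound on the derived length follows since the \<open>d\<close>-th derived subgroup lies in the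
  \<open>2\<^sup>d\<close>-th term of the lower central series.
\<close>

text \<open>One choice drives the subgroup theory: for a proper subgroup \<open>H\<close> some term
  of the lower central series is not contained in \<open>H\<close> while the next one is, and an
  element of the first outside \<open>H\<close> normalizes \<open>H\<close>. This yields growing
  normalizers, subgroups of all orders above a given one, and normality of subgroups of index
  \<open>p\<close>. The pairs of subgroups start at order \<open>p ^ 2\<close> because order
  \<open>p\<close> can occur just once: a generalized quaternion group has a single involution. The
  obstacle is a noncyclic \<open>p\<close>-group whose maximal subgroups are all cyclic; it is shown
  to have order at most \<open>p ^ 3\<close>, as the quaternion group of order 8 does. Above that,
  induction inside a noncyclic maximal subgroup supplies the pairs, and a third maximal subgroup
  makes up for the single subgroup of order \<open>p\<close>. The direct product is never formed.
  Its factors are subgroups of coprime order, which commute elementwise, and the projection onto a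
  Sylow factor is a power map.\<close>

section \<open>Commutators and the lower central series\<close>

context group
begin

abbreviation commutator :: "'a \<Rightarrow> 'a \<Rightarrow> 'a" where
  "commutator x y \<equiv> x \<otimes> y \<otimes> inv x \<otimes> inv y"

lemma inv_mult_cancel_left: "x \<in> carrier G \<Longrightarrow> y \<in> carrier G \<Longrightarrow> inv x \<otimes> (x \<otimes> y) = y"
  by (simp add: m_assoc[symmetric])

lemma mult_inv_cancel_left: "x \<in> carrier G \<Longrightarrow> y \<in> carrier G \<Longrightarrow> x \<otimes> (inv x \<otimes> y) = y"
  by (simp add: m_assoc[symmetric])

text \<open>With the default rules for units and inverses these rewrite a word to its reduced,
  right-nested form, so that identities of free groups fall to \<open>simp\<close>.\<close>

lemmas group_word_simps = m_assoc inv_mult_group inv_mult_cancel_left mult_inv_cancel_left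

lemma conj_commutator:
  assumes "g \<in> carrier G" "x \<in> carrier G" "y \<in> carrier G"
  shows "g \<otimes> commutator x y \<otimes> inv g = commutator (g \<otimes> x \<otimes> inv g) (g \<otimes> y \<otimes> inv g)"
  using assms by (simp add: group_word_simps)

lemma inv_commutator:
  assumes "x \<in> carrier G" "y \<in> carrier G"
  shows "inv (commutator x y) = commutator y x"
  using assms by (simp add: group_word_simps)

lemma commutator_mult_right:
  assumes "x \<in> carrier G" "y \<in> carrier G" "z \<in> carrier G"
  shows "commutator x (y \<otimes> z) = commutator x y \<otimes> (y \<otimes> commutator x z \<otimes> inv y)"
  using assms by (simp add: group_word_simps)

lemma commutator_inv_right:
  assumes "x \<in> carrier G" "y \<in> carrier G"
  shows "commutator x (inv y) = inv y \<otimes> inv (commutator x y) \<otimes> y"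
  using assms by (simp add: group_word_simps)

lemma commutator_eq_one_iff:
  assumes "x \<in> carrier G" "y \<in> carrier G"
  shows "commutator x y = \<one> \<longleftrightarrow> x \<otimes> y = y \<otimes> x"
proof -
  have "commutator x y = (x \<otimes> y) \<otimes> inv (y \<otimes> x)"
    using assms by (simp add: group_word_simps)
  thus ?thesis
    using assms inv_solve_right'[of "\<one>" "x \<otimes> y" "y \<otimes> x"] by simp
qed

lemma eq_inv_mult:
  assumes "a \<otimes> b \<otimes> c = \<one>" "a \<in> carrier G" "b \<in> carrier G" "c \<in> carrier G"
  shows "a = inv (b \<otimes> c)"
  using assms by (metis inv_equality m_assoc m_closed)

text \<open>If two of the three factors lie in a normal subgroup, so does the third. This is what
  bounds a commutator of two terms of the lower central series.\<close>

lemma Hall_Witt: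
  assumes "x \<in> carrier G" "y \<in> carrier G" "z \<in> carrier G"
  shows "(y \<otimes> commutator x (commutator (inv y) z) \<otimes> inv y) \<otimes>
         (z \<otimes> commutator y (commutator (inv z) x) \<otimes> inv z) \<otimes>
         (x \<otimes> commutator z (commutator (inv x) y) \<otimes> inv x) = \<one>"
  using assms by (simp add: group_word_simps)

lemma commutator_subgroup_subset:
  assumes "subgroup N G" and "\<And>x y. x \<in> A \<Longrightarrow> y \<in> B \<Longrightarrow> commutator x y \<in> N"
  shows "commutator_subgroup G A B \<subseteq> N"
  unfolding commutator_subgroup_def
  by (rule generate_subgroup_incl) (use assms in auto)

lemma commutator_in_commutator_subgroup:
  "x \<in> A \<Longrightarrow> y \<in> B \<Longrightarrow> commutator x y \<in> commutator_subgroup G A B"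
  unfolding commutator_subgroup_def by (rule generate.incl) auto

text \<open>The set of generating commutators is itself stable under conjugation, since the previous
  term is normal.\<close>

lemma lower_central_is_normal: "lower_central G i \<lhd> G"
proof (induction i)
  case 0
  show ?case using normal_self by simp
next
  case (Suc i)
  interpret N: normal "lower_central G i" G by (rule Suc)
  show ?case
    unfolding lower_central.simps commutator_subgroup_def
  proof (rule normal_generateI)
    fix h g
    assume h: "h \<in> (\<Union>a\<in>lower_central G i. \<Union>b\<in>carrier G. {commutator a b})"
      and g: "g \<in> carrier G"
    then obtain a b where "a \<in> lower_central G i" "b \<in> carrier G" "h = commutator a b" by auto
    hence "g \<otimes> h \<otimes> inv g = commutator (g \<otimes> a \<otimes> inv g) (g \<otimes> b \<otimes> inv g)"
      "g \<otimes> a \<otimes> inv g \<in> lower_central G i" "g \<otimes> b \<otimes> inv g \<in> carrier G"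
      using g conj_commutator N.inv_op_closed2 by auto
    thus "g \<otimes> h \<otimes> inv g \<in> (\<Union>a\<in>lower_central G i. \<Union>b\<in>carrier G. {commutator a b})"
      by blast
  qed (use N.subset in auto)
qed

lemma lower_central_is_subgroup: "subgroup (lower_central G i) G"
  using lower_central_is_normal normal_imp_subgroup by blast

lemma lower_central_subset_carrier: "lower_central G i \<subseteq> carrier G"
  using lower_central_is_subgroup subgroup.subset by blast

lemma commutator_lower_central:
  "x \<in> lower_central G i \<Longrightarrow> y \<in> carrier G \<Longrightarrow> commutator x y \<in> lower_central G (Suc i)"
  by (simp add: commutator_in_commutator_subgroup)

lemma commutator_lower_central':
  assumes "x \<in> lower_central G i" "y \<in> carrier G"
  shows "commutator y x \<in> lower_central G (Suc i)"
proof -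
  have "inv (commutator x y) \<in> lower_central G (Suc i)"
    using commutator_lower_central[OF assms] lower_central_is_subgroup subgroup.m_inv_closed by metis
  thus ?thesis
    using assms lower_central_subset_carrier by (metis inv_commutator subsetD)
qed

lemma lower_central_Suc_subset: "lower_central G (Suc i) \<subseteq> lower_central G i"
  unfolding lower_central.simps
proof (rule commutator_subgroup_subset[OF lower_central_is_subgroup])
  fix x y assume x: "x \<in> lower_central G i" and y: "y \<in> carrier G"
  interpret N: normal "lower_central G i" G by (rule lower_central_is_normal)
  have "commutator x y = x \<otimes> (y \<otimes> inv x \<otimes> inv y)"
    using x y by (simp add: m_assoc)
  thus "commutator x y \<in> lower_central G i"
    using x y N.inv_op_closed2 by simp
qed

lemma lower_central_antimono: "i \<le> j \<Longrightarrow> lower_central G j \<subseteq> lower_central G i"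
  using lower_central_Suc_subset lift_Suc_antimono_le by metis

lemma lower_central_stable:
  assumes "lower_central G (Suc i) = lower_central G i"
  shows "i \<le> j \<Longrightarrow> lower_central G j = lower_central G i"
  by (induction rule: dec_induct) (use assms in auto)

lemma lower_central_subgroup_subset:
  assumes "subgroup H G"
  shows "lower_central (G\<lparr>carrier := H\<rparr>) i \<subseteq> lower_central G i"
proof (induction i)
  case 0
  show ?case using assms subgroup.subset by auto
next
  case (Suc i)
  let ?K = "G\<lparr>carrier := H\<rparr>"
  interpret K: group ?K using assms subgroup_imp_group by blast
  have sub: "lower_central ?K i \<subseteq> H" using K.lower_central_subset_carrier by simp
  have "(\<Union>a\<in>lower_central ?K i. \<Union>b\<in>H. {a \<otimes> b \<otimes> inv\<^bsub>?K\<^esub> a \<otimes> inv\<^bsub>?K\<^esub> b})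
      = (\<Union>a\<in>lower_central ?K i. \<Union>b\<in>H. {commutator a b})"
    using sub assms by (intro SUP_cong refl) (auto simp: m_inv_consistent)
  moreover have "(\<Union>a\<in>lower_central ?K i. \<Union>b\<in>H. {commutator a b}) \<subseteq> H"
    using sub assms by (auto simp: subgroup.m_closed subgroup.m_inv_closed subset_iff)
  ultimately have "lower_central ?K (Suc i) = generate G (\<Union>a\<in>lower_central ?K i. \<Union>b\<in>H. {commutator a b})"
    using generate_consistent[OF _ assms] by (simp add: commutator_subgroup_def)
  also have "\<dots> \<subseteq> lower_central G (Suc i)"
    by (rule generate_subgroup_incl[OF _ lower_central_is_subgroup])
      (use Suc commutator_lower_central assms subgroup.mem_carrier in fastforce)
  finally show ?case .
qed

text \<open>Used for the projection onto a Sylow subgroup, where it shows that a deep nontrivial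
  element survives.\<close>

lemma hom_image_lower_central:
  assumes "group K" "h \<in> hom G K"
  shows "h ` lower_central G i \<subseteq> lower_central K i"
proof (induction i)
  case 0
  show ?case using assms(2) by (auto simp: hom_def)
next
  case (Suc i)
  interpret K: group K by fact
  interpret h: group_hom G K h by unfold_locales fact
  have *: "h (commutator a b) \<in> lower_central K (Suc i)"
    if "a \<in> lower_central G i" "b \<in> carrier G" for a b
  proof -
    have "h (commutator a b) = K.commutator (h a) (h b)"
      using that lower_central_subset_carrier by (simp add: subset_iff)
    thus ?thesis
      using K.commutator_lower_central[of "h a" i "h b"] that Suc by auto
  qed
  have "lower_central G (Suc i) \<subseteq> {x \<in> carrier G. h x \<in> lower_central K (Suc i)}" (is "_ \<subseteq> ?S")
    unfolding lower_central.simps(2)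
  proof (rule commutator_subgroup_subset)
    show "subgroup {x \<in> carrier G. h x \<in> commutator_subgroup K (lower_central K i) (carrier K)} G"
      using K.lower_central_is_subgroup[of "Suc i"]
      by (intro subgroupI)
         (auto simp: subgroup.m_closed subgroup.m_inv_closed subgroup.one_closed intro!: exI[of _ \<one>])
  qed (use * lower_central_subset_carrier in \<open>auto simp: subset_iff\<close>)
  thus ?case by blast
qed

text \<open>As \<open>lower_central G i\<close> is gamma_(i+1), this is [gamma_(i+1), gamma_(j+1)]
  \<le> gamma_(i+j+2). The induction on \<open>j\<close> leaves \<open>i\<close> arbitrary because
  the Hall-Witt identity trades a step in \<open>j\<close> for a step in \<open>i\<close>.\<close>

lemma commutator_lower_central_lower_central:
  assumes "x \<in> lower_central G i" "y \<in> lower_central G j"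
  shows "commutator x y \<in> lower_central G (Suc (i + j))"
  using assms
proof (induction j arbitrary: i x y)
  case 0
  thus ?case using commutator_lower_central by simp
next
  case (Suc j)
  let ?N = "lower_central G (Suc (Suc (i + j)))"
  interpret N: normal ?N G by (rule lower_central_is_normal)
  have lc: "x \<in> lower_central G l \<Longrightarrow> x \<in> carrier G" for x l
    using lower_central_subset_carrier by blast
  have lci: "x \<in> lower_central G l \<Longrightarrow> inv x \<in> lower_central G l" for x l
    using lower_central_is_subgroup subgroup.m_inv_closed by metis
  have conjN: "g \<otimes> n \<otimes> inv g \<in> ?N \<longleftrightarrow> n \<in> ?N" if "g \<in> carrier G" "n \<in> carrier G" for g n
  proof
    assume "g \<otimes> n \<otimes> inv g \<in> ?N"
    hence "inv g \<otimes> (g \<otimes> n \<otimes> inv g) \<otimes> g \<in> ?N" using N.inv_op_closed1 that by blast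
    thus "n \<in> ?N" using that by (simp add: group_word_simps)
  qed (use that N.inv_op_closed2 in auto)
  have gen: "commutator x (commutator y g) \<in> ?N"
    if x: "x \<in> lower_central G i" and y: "y \<in> lower_central G j" and g: "g \<in> carrier G" for x y g
  proof -
    have xc: "x \<in> carrier G" and yc: "y \<in> carrier G" using x y lc by auto
    \<comment> \<open>The three Hall-Witt factors up to conjugation; taking \<open>inv y\<close> as
      the middle variable turns \<open>?A\<close> into the wanted
      \<open>[x, [y, g]]\<close>.\<close>
    let ?A = "commutator x (commutator (inv (inv y)) g)"
      and ?B = "commutator (inv y) (commutator (inv g) x)"
      and ?C = "commutator g (commutator (inv x) (inv y))"
    \<comment> \<open>Here the induction hypothesis is needed one level deeper in \<open>i\<close>,
      at the same \<open>j\<close>.\<close>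
    have "commutator (inv g) x \<in> lower_central G (Suc i)"
      using commutator_lower_central' x g by blast
    hence "commutator (commutator (inv g) x) (inv y) \<in> ?N"
      using Suc.IH[of _ "Suc i" "inv y"] y lci by simp
    hence B: "?B \<in> ?N"
      using inv_commutator[of "commutator (inv g) x" "inv y"] xc yc g N.m_inv_closed by (metis inv_closed m_closed)
    have "commutator (inv x) (inv y) \<in> lower_central G (Suc (i + j))"
      using Suc.IH x y lci by blast
    hence C: "?C \<in> ?N"
      using commutator_lower_central' g by blast
    have "(inv y \<otimes> ?A \<otimes> inv (inv y)) \<otimes> (g \<otimes> ?B \<otimes> inv g) \<otimes> (x \<otimes> ?C \<otimes> inv x) = \<one>"
      using Hall_Witt[of x "inv y" g] xc yc g by simp
    hence "inv y \<otimes> ?A \<otimes> inv (inv y) = inv ((g \<otimes> ?B \<otimes> inv g) \<otimes> (x \<otimes> ?C \<otimes> inv x))"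
      by (rule eq_inv_mult) (use xc yc g in simp_all)
    moreover have "inv ((g \<otimes> ?B \<otimes> inv g) \<otimes> (x \<otimes> ?C \<otimes> inv x)) \<in> ?N"
      by (intro N.m_inv_closed N.m_closed N.inv_op_closed2 B C g xc)
    ultimately have "?A \<in> ?N" using conjN[of "inv y" ?A] xc yc g by simp
    thus ?thesis using yc by simp
  qed
  \<comment> \<open>Checking generators \<open>[y, g]\<close> is enough: as \<open>?N\<close> is
    normal, the elements \<open>z\<close> with all \<open>[x, z]\<close> in \<open>?N\<close> form a
    subgroup.\<close>
  have "lower_central G (Suc j) \<subseteq> {z \<in> carrier G. \<forall>x\<in>lower_central G i. commutator x z \<in> ?N}"
    unfolding lower_central.simps(2)[of G j]
  proof (rule commutator_subgroup_subset)
    show "subgroup {z \<in> carrier G. \<forall>x\<in>lower_central G i. commutator x z \<in> ?N} G" (is "subgroup ?Z G")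
    proof (rule subgroupI)
      show "?Z \<noteq> {}" using lc N.one_closed by (auto intro!: exI[of _ \<one>])
    next
      fix a assume a: "a \<in> ?Z"
      show "inv a \<in> ?Z"
      proof safe
        fix x assume x: "x \<in> lower_central G i"
        have "inv (commutator x a) \<in> ?N" using a x N.m_inv_closed by blast
        hence "inv a \<otimes> inv (commutator x a) \<otimes> a \<in> ?N" using a N.inv_op_closed1 by blast
        thus "commutator x (inv a) \<in> ?N" using a x lc commutator_inv_right by simp
      qed (use a in auto)
    next
      fix a b assume a: "a \<in> ?Z" and b: "b \<in> ?Z"
      show "a \<otimes> b \<in> ?Z"
      proof safe
        fix x assume x: "x \<in> lower_central G i"
        have "commutator x a \<otimes> (a \<otimes> commutator x b \<otimes> inv a) \<in> ?N"
          by (rule N.m_closed, use a b x in blast, rule N.inv_op_closed2) (use a b x in auto)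
        thus "commutator x (a \<otimes> b) \<in> ?N" using a b x lc commutator_mult_right by simp
      qed (use a b in auto)
    qed auto
  qed (use gen lc in auto)
  thus ?case using Suc.prems by (auto simp del: lower_central.simps)
qed

text \<open>The index \<open>2 ^ d - 1\<close> stands for gamma_(2^d); the exponent doubles since
  commutators add the indices of the gammas.\<close>

lemma derived_pow_subset_lower_central:
  "(derived G ^^ d) (carrier G) \<subseteq> lower_central G (2 ^ d - 1)"
proof (induction d)
  case (Suc d)
  have "derived G ((derived G ^^ d) (carrier G)) \<subseteq> lower_central G (2 ^ Suc d - 1)"
    unfolding derived_def[of G "(derived G ^^ d) (carrier G)"]
  proof (rule generate_subgroup_incl[OF _ lower_central_is_subgroup], rule subsetI)
    fix z assume "z \<in> derived_set G ((derived G ^^ d) (carrier G))"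
    then obtain x y where xy: "x \<in> (derived G ^^ d) (carrier G)" "y \<in> (derived G ^^ d) (carrier G)"
      and z: "z = commutator x y" by auto
    have "commutator x y \<in> lower_central G (Suc ((2 ^ d - 1) + (2 ^ d - 1)))"
      using xy Suc commutator_lower_central_lower_central by blast
    moreover have "Suc ((2 ^ d - 1) + (2 ^ d - 1)) = 2 ^ Suc d - (1::nat)"
      by (cases "2 ^ d :: nat") auto
    ultimately show "z \<in> lower_central G (2 ^ Suc d - 1)" using z by metis
  qed
  thus ?case by simp
qed auto

end

section \<open>Nilpotent groups\<close>

declare lower_central.simps(2) [simp del]

lemma (in group_hom) hom_commutator:
  assumes "a \<in> carrier G" "b \<in> carrier G"
  shows "h (G.commutator a b) = H.commutator (h a) (h b)"
  using assms by simp

context group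
begin

lemma nilpotent_subgroup:
  assumes "nilpotent_group G" "subgroup H G"
  shows "nilpotent_group (G\<lparr>carrier := H\<rparr>)"
proof -
  interpret K: group "G\<lparr>carrier := H\<rparr>" using assms subgroup_imp_group by blast
  obtain c where "lower_central G c = {\<one>}" using assms(1) nilpotent_group_def by metis
  hence "lower_central (G\<lparr>carrier := H\<rparr>) c \<subseteq> {\<one>}"
    using lower_central_subgroup_subset[OF assms(2)] by metis
  moreover have "\<one> \<in> lower_central (G\<lparr>carrier := H\<rparr>) c"
    using subgroup.one_closed[OF K.lower_central_is_subgroup] by simp
  ultimately show ?thesis
    unfolding nilpotent_group_def using K.is_group by auto
qed

text \<open>A repeated term would make the series constant from there on, so it could not reach the
  trivial subgroup.\<close>

lemma nilpotent_lower_central_strict: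
  assumes "nilpotent_group G" "lower_central G i \<noteq> {\<one>}"
  shows "lower_central G (Suc i) \<subset> lower_central G i"
proof -
  obtain c where c: "lower_central G c = {\<one>}" using assms(1) nilpotent_group_def by metis
  have one: "{\<one>} \<subseteq> lower_central G i" using subgroup.one_closed[OF lower_central_is_subgroup] by simp
  have "i \<le> c" using assms(2) c lower_central_antimono[of c i] one by (metis nle_le subset_antisym)
  hence "lower_central G (Suc i) \<noteq> lower_central G i"
    using lower_central_stable[of i c] c assms(2) by metis
  thus ?thesis using lower_central_Suc_subset by blast
qed

text \<open>The place where the descending series enters \<open>H\<close>. It exists because the
  series starts outside the proper subgroup \<open>H\<close> and ends at the trivial
  subgroup.\<close>

lemma nilpotent_proper_subgroup_level:
  assumes "nilpotent_group G" "subgroup H G" "H \<noteq> carrier G"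
  obtains i where "\<not> lower_central G i \<subseteq> H" "lower_central G (Suc i) \<subseteq> H"
proof -
  obtain c where c: "lower_central G c = {\<one>}" using assms(1) nilpotent_group_def by metis
  hence ex: "lower_central G c \<subseteq> H" using assms(2) subgroup.one_closed by auto
  have "\<not> lower_central G 0 \<subseteq> H" using assms subgroup.subset by auto
  moreover have "lower_central G 0 \<subseteq> H" if "\<And>i. lower_central G (Suc i) \<subseteq> H \<Longrightarrow> lower_central G i \<subseteq> H"
    by (rule inc_induct[of 0 c "\<lambda>i. lower_central G i \<subseteq> H"]) (use ex that in auto)
  ultimately show ?thesis using that by blast
qed

text \<open>An element of the last term not contained in \<open>H\<close> normalizes
  \<open>H\<close>: its commutators with \<open>H\<close> lie in the next term, hence in
  \<open>H\<close>.\<close>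

lemma nilpotent_normalizer_neq:
  assumes "nilpotent_group G" "subgroup H G" "H \<noteq> carrier G"
  shows "normalizer G H \<noteq> H"
proof -
  obtain i where i: "\<not> lower_central G i \<subseteq> H" "lower_central G (Suc i) \<subseteq> H"
    using nilpotent_proper_subgroup_level assms by blast
  then obtain g where g: "g \<in> lower_central G i" "g \<notin> H" by blast
  have gc: "g \<in> carrier G" using g lower_central_subset_carrier by blast
  have conj: "x \<otimes> h \<otimes> inv x \<in> H" if "x \<in> lower_central G i" "h \<in> H" for x h
  proof -
    have xc: "x \<in> carrier G" using that lower_central_subset_carrier by blast
    have hc: "h \<in> carrier G" using that subgroup.mem_carrier[OF assms(2)] by blast
    have "commutator x h \<in> H" using i that hc commutator_lower_central by blast
    hence "commutator x h \<otimes> h \<in> H" using that subgroup.m_closed[OF assms(2)] by blast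
    thus ?thesis using xc hc by (simp add: group_word_simps)
  qed
  \<comment> \<open>Conjugation by \<open>inv g\<close> gives the reverse inclusion, as
    \<open>normalizer\<close> asks for equality of sets.\<close>
  have gi: "inv g \<in> lower_central G i"
    using g subgroup.m_inv_closed[OF lower_central_is_subgroup] by blast
  have "g <# H #> inv g = H"
  proof
    show "g <# H #> inv g \<subseteq> H"
      using conj g by (auto simp: l_coset_def r_coset_def)
    show "H \<subseteq> g <# H #> inv g"
    proof
      fix h assume h: "h \<in> H"
      have hc: "h \<in> carrier G" using h subgroup.mem_carrier[OF assms(2)] by blast
      have "inv g \<otimes> h \<otimes> g \<in> H" using conj[OF gi h] gc by simp
      moreover have "h = g \<otimes> (inv g \<otimes> h \<otimes> g) \<otimes> inv g"
        using gc hc by (simp add: group_word_simps)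
      ultimately show "h \<in> g <# H #> inv g" unfolding l_coset_def r_coset_def by blast
    qed
  qed
  hence "g \<in> normalizer G H"
    using gc assms(2) subgroup.subset by (auto simp: normalizer_def stabilizer_def)
  thus ?thesis using g by blast
qed

text \<open>Hides cosets behind a homomorphism known only by its kernel, so later arguments compute
  with elements of an abstract group.\<close>

lemma quotient_hom:
  assumes "N \<lhd> G"
  obtains Q :: "'a set monoid" and h
  where "group_hom G Q h" "\<And>x. x \<in> carrier G \<Longrightarrow> h x = \<one>\<^bsub>Q\<^esub> \<longleftrightarrow> x \<in> N"
proof -
  interpret N: normal N G by fact
  interpret Q: group "G Mod N" by (rule N.factorgroup_is_group)
  have "group_hom G (G Mod N) (\<lambda>x. N #> x)"
    by unfold_locales (rule N.r_coset_hom_Mod)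
  moreover have "N #> x = \<one>\<^bsub>G Mod N\<^esub> \<longleftrightarrow> x \<in> N" if "x \<in> carrier G" for x
    using that coset_join1[of N x] coset_join2[of x N] N.is_subgroup by auto
  ultimately show ?thesis by (rule that)
qed

text \<open>Commutators are encoded by \<open>x \<otimes> y = c \<otimes> (y \<otimes> x)\<close>, which avoids inverses.\<close>
lemma commuting_commutator_pow:
  assumes "x \<otimes> y = c \<otimes> (y \<otimes> x)" "c \<otimes> x = x \<otimes> c"
    and [simp]: "x \<in> carrier G" "y \<in> carrier G" "c \<in> carrier G"
  shows "x [^] n \<otimes> y = c [^] n \<otimes> (y \<otimes> x [^] (n::nat))"
proof (induction n)
  case (Suc n)
  have xc: "x \<otimes> c [^] n = c [^] n \<otimes> x"
    using group_commutes_pow[of c x n] assms by simp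
  have "x [^] Suc n \<otimes> y = x \<otimes> (x [^] n \<otimes> y)"
    unfolding nat_pow_Suc2[OF assms(3)] by (simp add: m_assoc)
  also have "\<dots> = (x \<otimes> c [^] n) \<otimes> (y \<otimes> x [^] n)" by (simp add: Suc m_assoc)
  also have "\<dots> = c [^] n \<otimes> ((x \<otimes> y) \<otimes> x [^] n)" by (simp add: xc m_assoc)
  also have "\<dots> = c [^] n \<otimes> c \<otimes> (y \<otimes> (x \<otimes> x [^] n))" unfolding assms(1) by (simp add: m_assoc)
  also have "\<dots> = c [^] Suc n \<otimes> (y \<otimes> x [^] Suc n)" 
    unfolding nat_pow_Suc2[OF assms(3)] by simp
  finally show ?case .
qed simp

text \<open>The power formula of class two. Moving \<open>v ^ n\<close> past one more
  \<open>x\<close> costs \<open>c ^ n\<close>, and these exponents sum to the binomial coefficient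
  \<open>n\<close> over 2.\<close>

lemma mult_pow_commuting_commutator:
  assumes "v \<otimes> x = c \<otimes> (x \<otimes> v)" "c \<otimes> x = x \<otimes> c" "c \<otimes> v = v \<otimes> c"
    and [simp]: "x \<in> carrier G" "v \<in> carrier G" "c \<in> carrier G"
  shows "(x \<otimes> v) [^] n = c [^] (n * (n - 1) div 2) \<otimes> (x [^] n \<otimes> v [^] (n::nat))"
proof (induction n)
  case (Suc n)
  let ?t = "n * (n - 1) div 2"
  have xc: "x [^] n \<otimes> c [^] n = c [^] n \<otimes> x [^] n"
    using group_commutes_pow[of "c [^] n" x] group_commutes_pow[of c x n] group_commutes_pow[of x "c [^] n" n] assms by simp
  have t: "Suc n * (Suc n - 1) div 2 = ?t + n"
    by (cases n) (auto simp: algebra_simps)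
  have "(x \<otimes> v) [^] Suc n = c [^] ?t \<otimes> (x [^] n \<otimes> ((v [^] n \<otimes> x) \<otimes> v))"
    by (simp add: Suc m_assoc)
  also have "\<dots> = c [^] ?t \<otimes> ((x [^] n \<otimes> c [^] n) \<otimes> (x \<otimes> (v [^] n \<otimes> v)))"
    using commuting_commutator_pow[of v x c n] assms by (simp add: m_assoc)
  also have "\<dots> = (c [^] ?t \<otimes> c [^] n) \<otimes> (x [^] Suc n \<otimes> v [^] Suc n)"
    unfolding xc by (simp add: m_assoc)
  also have "c [^] ?t \<otimes> c [^] n = c [^] (Suc n * (Suc n - 1) div 2)"
    by (simp only: t nat_pow_mult[OF assms(6)])
  finally show ?case .
qed simp

text \<open>Since \<open>c\<close> commutes with \<open>x\<close>, the commutator of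
  \<open>x ^ n\<close> and \<open>y\<close> is \<open>c ^ n\<close>.\<close>

lemma commutator_pow_eq_one:
  assumes c: "c = commutator x y" "c \<otimes> x = x \<otimes> c" and x: "x \<in> carrier G" "y \<in> carrier G"
    and xy: "x [^] (n::nat) \<otimes> y = y \<otimes> x [^] n"
  shows "c [^] n = \<one>"
proof -
  have cc: "c \<in> carrier G" using c x by simp
  have "x \<otimes> y = c \<otimes> (y \<otimes> x)" using c x by (simp add: group_word_simps)
  hence "x [^] n \<otimes> y = c [^] n \<otimes> (y \<otimes> x [^] n)"
    using commuting_commutator_pow c x cc by blast
  hence "\<one> \<otimes> (y \<otimes> x [^] n) = c [^] n \<otimes> (y \<otimes> x [^] n)" using xy x by simp
  thus ?thesis using cc x by (metis m_closed nat_pow_closed one_closed r_cancel)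
qed

lemma pow_coprime_eq_one:
  assumes "x \<in> carrier G" "x [^] (m::nat) = \<one>" "x [^] (n::nat) = \<one>" "coprime m n"
  shows "x = \<one>"
proof -
  have "ord x dvd m" "ord x dvd n" using assms pow_eq_id by auto
  hence "ord x = 1" using assms(4) by (metis coprime_common_divisor_nat)
  thus ?thesis using assms(1) ord_eq_1 by blast
qed

text \<open>The exponent \<open>m\<close> of \<open>x\<close> kills \<open>c\<close>; the exponent
  \<open>n\<close> of \<open>y\<close> kills \<open>inv c\<close>, which is the commutator with the
  arguments exchanged.\<close>

lemma coprime_orders_commutator_eq_one:
  assumes c: "c = commutator x y" "c \<otimes> x = x \<otimes> c" "c \<otimes> y = y \<otimes> c"
    and x: "x \<in> carrier G" "y \<in> carrier G"
    and pow: "x [^] (m::nat) = \<one>" "y [^] (n::nat) = \<one>" "coprime m n"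
  shows "c = \<one>"
proof -
  have cc: "c \<in> carrier G" using c x by simp
  have ic: "inv c = commutator y x" using inv_commutator c x by simp
  have "inv c \<otimes> y = y \<otimes> inv c"
    using c(3) cc x by (metis inv_comm inv_solve_left inv_solve_right m_assoc m_closed inv_closed)
  hence "inv c [^] n = \<one>"
    using commutator_pow_eq_one[OF ic] x pow by simp
  hence "c [^] n = \<one>" using cc by (metis inv_inv inv_closed nat_pow_inv inv_one)
  moreover have "c [^] m = \<one>"
    using commutator_pow_eq_one[OF c(1)] c x pow by simp
  ultimately show ?thesis using pow_coprime_eq_one cc pow by blast
qed

text \<open>The commutator sinks through the whole lower central series: once in one term, it is
  central modulo the next, and the preceding lemma makes it trivial in that quotient.\<close>

lemma nilpotent_coprime_commute:
  assumes "nilpotent_group G" and x: "x \<in> carrier G" "y \<in> carrier G"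
    and pow: "x [^] (m::nat) = \<one>" "y [^] (n::nat) = \<one>" "coprime m n"
  shows "x \<otimes> y = y \<otimes> x"
proof -
  have "commutator x y \<in> lower_central G i" for i
  proof (induction i)
    case 0
    show ?case using x by simp
  next
    case (Suc i)
    let ?N = "lower_central G (Suc i)"
    obtain Q :: "'a set monoid" and h where hom: "group_hom G Q h"
      and ker: "\<And>x. x \<in> carrier G \<Longrightarrow> h x = \<one>\<^bsub>Q\<^esub> \<longleftrightarrow> x \<in> ?N"
      using quotient_hom[OF lower_central_is_normal] by blast
    interpret h: group_hom G Q h by (rule hom)
    let ?c = "commutator x y"
    have cc: "?c \<in> carrier G" using x by simp
    have comm: "h ?c \<otimes>\<^bsub>Q\<^esub> h z = h z \<otimes>\<^bsub>Q\<^esub> h ?c" if z: "z \<in> carrier G" for z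
    proof -
      have "commutator ?c z \<in> ?N" using commutator_lower_central Suc z by blast
      moreover have "commutator ?c z \<in> carrier G" using x z by simp
      ultimately have "h (commutator ?c z) = \<one>\<^bsub>Q\<^esub>" using ker by blast
      hence "h.H.commutator (h ?c) (h z) = \<one>\<^bsub>Q\<^esub>" unfolding h.hom_commutator[OF cc z] .
      thus ?thesis using h.H.commutator_eq_one_iff cc z h.hom_closed by blast
    qed
    have "h ?c = \<one>\<^bsub>Q\<^esub>"
    proof (rule h.H.coprime_orders_commutator_eq_one)
      show "h ?c = h.H.commutator (h x) (h y)" by (rule h.hom_commutator[OF x])
      show "h ?c \<otimes>\<^bsub>Q\<^esub> h x = h x \<otimes>\<^bsub>Q\<^esub> h ?c" "h ?c \<otimes>\<^bsub>Q\<^esub> h y = h y \<otimes>\<^bsub>Q\<^esub> h ?c"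
        using comm x by blast+
      show "h x [^]\<^bsub>Q\<^esub> m = \<one>\<^bsub>Q\<^esub>" "h y [^]\<^bsub>Q\<^esub> n = \<one>\<^bsub>Q\<^esub>"
        using h.hom_nat_pow[of x m] h.hom_nat_pow[of y n] x pow h.hom_one by simp_all
    qed (use x pow in auto)
    thus ?case using ker cc by blast
  qed
  thus ?thesis using assms(1) x commutator_eq_one_iff unfolding nilpotent_group_def by blast
qed

section \<open>Adjoining one normalizing element to a subgroup of a finite group\<close>

lemma finite_subgroupI:
  assumes fin: "finite (carrier G)" and K: "K \<subseteq> carrier G" "\<one> \<in> K"
    and mult: "\<And>x y. x \<in> K \<Longrightarrow> y \<in> K \<Longrightarrow> x \<otimes> y \<in> K"
  shows "subgroup K G"
proof (rule subgroupI)
  fix x assume x: "x \<in> K"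
  have pow: "x [^] (n::nat) \<in> K" for n
    by (induction n) (use x mult K in auto)
  have "order G > 0" using fin by (simp add: order_gt_0_iff_finite)
  hence "x [^] (order G - 1) \<otimes> x = \<one>"
    using pow_order_eq_1[of x] x K by (metis Suc_diff_1 nat_pow_Suc subsetD)
  hence "inv x = x [^] (order G - 1)" using x K by (metis inv_equality nat_pow_closed subsetD)
  thus "inv x \<in> K" using pow by simp
qed (use assms in auto)

text \<open>By Bezout, \<open>g\<close> is a product of integer powers of \<open>g ^ m\<close> and
  \<open>g ^ n\<close>.\<close>

lemma coprime_pow_mem:
  assumes H: "subgroup H G" and g: "g \<in> carrier G"
    and mem: "g [^] (m::nat) \<in> H" "g [^] (n::nat) \<in> H" and "coprime m n"
  shows "g \<in> H"
proof -
  obtain u v where uv: "u * int m + v * int n = 1"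
    using bezout_int[of "int m" "int n"] \<open>coprime m n\<close> by auto
  have "(g [^] int m) [^] u \<otimes> (g [^] int n) [^] v \<in> H"
    by (rule subgroup.m_closed[OF H]; rule subgroup_int_pow_closed[OF H])
      (use mem in \<open>simp_all only: int_pow_int\<close>)
  also have "(g [^] int m) [^] u \<otimes> (g [^] int n) [^] v = g [^] (u * int m + v * int n)"
    using g by (simp add: int_pow_pow int_pow_mult mult.commute)
  finally show ?thesis using uv g by simp
qed

text \<open>The subgroup generated by \<open>H\<close> and \<open>g\<close> when \<open>g\<close>
  normalizes \<open>H\<close> and the group is finite; finiteness is why natural exponents
  suffice.\<close>

definition adjoin :: "'a set \<Rightarrow> 'a \<Rightarrow> 'a set" where
  "adjoin H g = (\<lambda>(h, j::nat). h \<otimes> g [^] j) ` (H \<times> UNIV)"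

lemma conj_pow_mem:
  assumes "subgroup H G" "g \<in> carrier G" "\<And>h. h \<in> H \<Longrightarrow> g \<otimes> h \<otimes> inv g \<in> H" "h \<in> H"
  shows "g [^] (j::nat) \<otimes> h \<otimes> inv (g [^] j) \<in> H"
proof (induction j)
  case (Suc j)
  have "h \<in> carrier G" using assms(4) subgroup.mem_carrier[OF assms(1)] by blast
  hence "g [^] Suc j \<otimes> h \<otimes> inv (g [^] Suc j) = g \<otimes> (g [^] j \<otimes> h \<otimes> inv (g [^] j)) \<otimes> inv g"
    unfolding nat_pow_Suc2[OF assms(2)] using assms(2) by (simp add: group_word_simps)
  thus ?case using Suc assms by simp
qed (use assms subgroup.mem_carrier[OF assms(1)] in auto)

lemma adjoin_subgroup:
  assumes "finite (carrier G)" and H: "subgroup H G" and g: "g \<in> carrier G"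
    and conj: "\<And>h. h \<in> H \<Longrightarrow> g \<otimes> h \<otimes> inv g \<in> H"
  shows "subgroup (adjoin H g) G"
proof (rule finite_subgroupI)
  have Hc: "h \<in> H \<Longrightarrow> h \<in> carrier G" for h using subgroup.mem_carrier[OF H] by blast
  show "adjoin H g \<subseteq> carrier G" using Hc g by (auto simp: adjoin_def)
  show "\<one> \<in> adjoin H g"
    using subgroup.one_closed[OF H] by (auto simp: adjoin_def intro!: image_eqI[of _ _ "(\<one>, 0)"])
  fix x y assume "x \<in> adjoin H g" "y \<in> adjoin H g"
  then obtain h i k j where x: "x = h \<otimes> g [^] (i::nat)" "h \<in> H" and y: "y = k \<otimes> g [^] (j::nat)" "k \<in> H"
    by (auto simp: adjoin_def)
  have "x \<otimes> y = (h \<otimes> (g [^] i \<otimes> k \<otimes> inv (g [^] i))) \<otimes> g [^] (i + j)"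
    using x y Hc g by (simp add: group_word_simps nat_pow_mult[symmetric])
  moreover have "h \<otimes> (g [^] i \<otimes> k \<otimes> inv (g [^] i)) \<in> H"
    using conj_pow_mem[OF H g conj] x y subgroup.m_closed[OF H] by blast
  ultimately show "x \<otimes> y \<in> adjoin H g" by (auto simp: adjoin_def)
qed (use assms in auto)

lemma subset_adjoin:
  assumes "subgroup H G" "g \<in> carrier G"
  shows "H \<subseteq> adjoin H g" "g \<in> adjoin H g"
proof -
  show "H \<subseteq> adjoin H g"
    using subgroup.mem_carrier[OF assms(1)]
    by (auto simp: adjoin_def intro!: image_eqI[of _ _ "(_, 0)"])
  show "g \<in> adjoin H g"
    using subgroup.one_closed[OF assms(1)] assms(2)
    by (auto simp: adjoin_def intro!: image_eqI[of _ _ "(\<one>, 1)"])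
qed

text \<open>The cosets of \<open>H\<close> by \<open>g ^ j\<close> with \<open>j < p\<close> are
  distinct: a coincidence would put a power of \<open>g\<close> with exponent prime to
  \<open>p\<close> into \<open>H\<close>, and then \<open>g\<close> itself.\<close>

lemma card_adjoin:
  assumes "finite (carrier G)" and H: "subgroup H G" and g: "g \<in> carrier G" "g \<notin> H"
    and p: "Factorial_Ring.prime p" "g [^] (p::nat) \<in> H"
  shows "card (adjoin H g) = p * card H"
proof -
  have Hc: "h \<in> H \<Longrightarrow> h \<in> carrier G" for h using subgroup.mem_carrier[OF H] by blast
  let ?f = "\<lambda>(h, j::nat). h \<otimes> g [^] j"
  have "adjoin H g = ?f ` (H \<times> {..<p})"
  proof
    show "adjoin H g \<subseteq> ?f ` (H \<times> {..<p})"
    proof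
      fix x assume "x \<in> adjoin H g"
      then obtain h j where x: "x = h \<otimes> g [^] (j::nat)" "h \<in> H" by (auto simp: adjoin_def)
      have pw: "(g [^] p) [^] n \<in> H" for n :: nat
        by (induction n) (use p H in \<open>simp_all add: subgroup.one_closed subgroup.m_closed\<close>)
      have "g [^] j = (g [^] p) [^] (j div p) \<otimes> g [^] (j mod p)"
        using g by (simp add: nat_pow_pow nat_pow_mult)
      hence "x = (h \<otimes> (g [^] p) [^] (j div p)) \<otimes> g [^] (j mod p)"
        using x g Hc by (simp add: m_assoc)
      moreover have "h \<otimes> (g [^] p) [^] (j div p) \<in> H" using pw x subgroup.m_closed[OF H] by blast
      moreover have "j mod p < p" using p prime_gt_0_nat by simp
      ultimately show "x \<in> ?f ` (H \<times> {..<p})" by auto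
    qed
  qed (auto simp: adjoin_def)
  moreover have "inj_on ?f (H \<times> {..<p})"
  proof -
    have *: "i = j \<and> h = k"
      if hk: "h \<in> H" "k \<in> H" and ij: "i \<le> j" "j < p" and eq: "h \<otimes> g [^] i = k \<otimes> g [^] j" 
      for h k and i j :: nat
    proof -
      have "k \<otimes> g [^] j = k \<otimes> g [^] (j - i) \<otimes> g [^] i"
        using ij g hk Hc by (simp add: m_assoc nat_pow_mult)
      hence "h = k \<otimes> g [^] (j - i)" using eq g hk Hc by simp
      hence "g [^] (j - i) = inv k \<otimes> h" using g hk Hc by (simp add: group_word_simps)
      hence mem: "g [^] (j - i) \<in> H" using hk H by (simp add: subgroup.m_closed subgroup.m_inv_closed)
      have "i = j"
      proof (rule ccontr)
        assume "i \<noteq> j"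
        hence "coprime p (j - i)" using ij p
          by (intro prime_imp_coprime) (auto dest: dvd_imp_le)
        thus False using coprime_pow_mem[OF H g(1) p(2) mem] g by simp
      qed
      thus ?thesis using eq g hk Hc by simp
    qed
    show ?thesis
    proof (rule inj_onI)
      fix u v assume uv: "u \<in> H \<times> {..<p}" "v \<in> H \<times> {..<p}" "?f u = ?f v"
      obtain h i k j where hk: "u = (h, i)" "v = (k, j)" by (cases u, cases v)
      have "h \<in> H" "k \<in> H" "i < p" "j < p" "h \<otimes> g [^] i = k \<otimes> g [^] j"
        using uv unfolding hk by auto
      hence "i = j \<and> h = k" using *[of h k i j] *[of k h j i] by (metis nle_le)
      thus "u = v" using hk by simp
    qed
  qed
  ultimately show ?thesis by (simp add: card_image card_cartesian_product)
qed

end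

section \<open>Nilpotent p-groups\<close>

text \<open>The groups used here are subgroups of a nilpotent group, so nilpotency comes by
  inheritance and is a locale assumption.\<close>

locale nilpotent_p_group = group G for G (structure) +
  fixes p a :: nat
  assumes prime_p: "Factorial_Ring.prime p" and nilpotent: "nilpotent_group G" and order_eq: "order G = p ^ a"
begin

lemma finite_carrier: "finite (carrier G)"
  using order_eq prime_p prime_gt_0_nat by (metis order_gt_0_iff_finite zero_less_power)

lemma p_gt_1: "p > 1"
  using prime_p prime_gt_1_nat by blast

lemma finite_subgroup: "subgroup H G \<Longrightarrow> finite H"
  by (rule finite_subset[OF subgroup.subset finite_carrier])

lemma card_eq_imp_carrier: "subgroup H G \<Longrightarrow> card H = p ^ a \<Longrightarrow> H = carrier G"
  using card_subset_eq[OF finite_carrier, of H] subgroup.subset[of H G] order_eq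
  unfolding order_def by simp

lemma subgroup_card:
  assumes "subgroup H G"
  obtains b where "b \<le> a" "card H = p ^ b"
proof -
  have "card H dvd p ^ a"
    using lagrange_finite[OF finite_carrier assms] order_eq by (metis dvd_triv_right)
  thus ?thesis using that divides_primepow_nat[OF prime_p] by blast
qed

lemma subgroup_card_less:
  assumes "subgroup H G" "H \<noteq> carrier G" "card H = p ^ b"
  shows "b < a"
proof -
  obtain b' where "b' \<le> a" "card H = p ^ b'" using subgroup_card assms(1) by blast
  hence "b \<le> a" using assms(3) p_gt_1 by simp
  thus ?thesis using card_eq_imp_carrier assms by (metis le_neq_implies_less)
qed

lemma subgroup_nilpotent_p_group:
  assumes "subgroup H G" "card H = p ^ b"
  shows "nilpotent_p_group (G\<lparr>carrier := H\<rparr>) p b"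
proof -
  interpret H: group "G\<lparr>carrier := H\<rparr>" using assms subgroup_imp_group by blast
  show ?thesis
    by unfold_locales (use assms prime_p nilpotent nilpotent_subgroup in \<open>auto simp: order_def\<close>)
qed

text \<open>For normal \<open>H\<close> the image of \<open>g\<close> is a central element of order
  \<open>p\<close> in the quotient; the wording with commutators also covers subgroups that are not
  normal.\<close>

lemma central_extension_element:
  assumes H: "subgroup H G" "H \<noteq> carrier G"
  obtains g where "g \<in> carrier G" "g \<notin> H" "g [^] p \<in> H" "\<And>x. x \<in> carrier G \<Longrightarrow> commutator g x \<in> H"
proof -
  obtain i where i: "\<not> lower_central G i \<subseteq> H" "lower_central G (Suc i) \<subseteq> H"
    using nilpotent_proper_subgroup_level[OF nilpotent H] by blast
  then obtain u where u: "u \<in> lower_central G i" "u \<notin> H" by blast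
  have uc: "u \<in> carrier G" using u lower_central_subset_carrier by blast
  have "u [^] (p ^ a) \<in> H"
    using pow_order_eq_1[OF uc] order_eq subgroup.one_closed[OF H(1)] by simp
  moreover have "u [^] (p ^ 0) \<notin> H" using u uc by simp
  \<comment> \<open>Passing from \<open>u\<close> to the power \<open>u ^ (p ^ j)\<close> keeps it
    in the same term of the series and brings its \<open>p\<close>-th power into
    \<open>H\<close>.\<close>
  ultimately obtain j where j: "u [^] (p ^ j) \<notin> H" "u [^] (p ^ Suc j) \<in> H"
    using inc_induct[of 0 a "\<lambda>j. u [^] (p ^ j) \<in> H"] by blast
  have pow: "u [^] n \<in> lower_central G i" for n :: nat
    by (induction n)
       (use u lower_central_is_subgroup in \<open>simp_all add: subgroup.one_closed subgroup.m_closed\<close>)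
  show ?thesis
  proof
    show "(u [^] (p ^ j)) [^] p \<in> H" using j(2) uc by (simp add: nat_pow_pow mult.commute)
    show "commutator (u [^] (p ^ j)) x \<in> H" if "x \<in> carrier G" for x
      using commutator_lower_central[OF pow that] i by blast
  qed (use j uc in auto)
qed

lemma commutator_mem_imp_conj_mem:
  assumes "subgroup H G" "g \<in> carrier G" "\<And>x. x \<in> carrier G \<Longrightarrow> commutator g x \<in> H" "h \<in> H"
  shows "g \<otimes> h \<otimes> inv g \<in> H"
proof -
  have hc: "h \<in> carrier G" using assms(4) subgroup.mem_carrier[OF assms(1)] by blast
  have "commutator g h \<otimes> h \<in> H" using assms hc subgroup.m_closed[OF assms(1)] by blast
  thus ?thesis using assms(2) hc by (simp add: group_word_simps)
qed

text \<open>Adjoins the element just constructed. All its commutators lie in \<open>H\<close>, so if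
  \<open>H\<close> is normal, the new subgroup is central modulo \<open>H\<close> and hence
  normal.\<close>

lemma extend_subgroup:
  assumes H: "subgroup H G" "card H = p ^ b" "b < a"
  obtains K where "subgroup K G" "H \<subseteq> K" "card K = p ^ Suc b" "H \<lhd> G \<Longrightarrow> K \<lhd> G"
proof -
  have "card H \<noteq> order G" using H order_eq p_gt_1 by simp
  hence "H \<noteq> carrier G" by (auto simp: order_def)
  then obtain g where g: "g \<in> carrier G" "g \<notin> H" "g [^] p \<in> H"
    and gH: "\<And>x. x \<in> carrier G \<Longrightarrow> commutator g x \<in> H"
    using central_extension_element H by blast
  have conj: "h \<in> H \<Longrightarrow> g \<otimes> h \<otimes> inv g \<in> H" for h
    using commutator_mem_imp_conj_mem[OF H(1) g(1) gH] by blast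
  let ?K = "adjoin H g"
  have K: "subgroup ?K G" using adjoin_subgroup[OF finite_carrier H(1) g(1) conj] .
  have "?K \<lhd> G" if norm: "H \<lhd> G"
    unfolding normal_inv_iff
  proof (intro conjI ballI K)
    fix x z assume x: "x \<in> carrier G" and z: "z \<in> ?K"
    then obtain h j where hj: "h \<in> H" "z = h \<otimes> g [^] (j::nat)" by (auto simp: adjoin_def)
    have hc: "h \<in> carrier G" using hj subgroup.mem_carrier[OF H(1)] by blast
    have gx: "x \<otimes> g \<otimes> inv x \<in> ?K"
    proof -
      have "x \<otimes> g \<otimes> inv x = inv (commutator g x) \<otimes> g"
        using x g by (simp add: group_word_simps)
      moreover have "inv (commutator g x) \<in> ?K"
        using gH x H(1) subgroup.m_inv_closed[OF H(1)] subset_adjoin[OF H(1) g(1)] by blast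
      ultimately show ?thesis
        using subset_adjoin[OF H(1) g(1)] subgroup.m_closed[OF K] by simp
    qed
    have pow: "x \<otimes> g [^] j \<otimes> inv x \<in> ?K" for j :: nat
    proof (induction j)
      case 0
      thus ?case using x subgroup.one_closed[OF K] by simp
    next
      case (Suc j)
      have "x \<otimes> g [^] Suc j \<otimes> inv x = (x \<otimes> g [^] j \<otimes> inv x) \<otimes> (x \<otimes> g \<otimes> inv x)"
        using x g by (simp add: group_word_simps)
      thus ?case using Suc gx subgroup.m_closed[OF K] by simp
    qed
    have "x \<otimes> h \<otimes> inv x \<in> ?K"
      using norm x hj subset_adjoin(1)[OF H(1) g(1)] unfolding normal_inv_iff by blast
    moreover have "x \<otimes> z \<otimes> inv x = (x \<otimes> h \<otimes> inv x) \<otimes> (x \<otimes> g [^] j \<otimes> inv x)"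
      using x hc g hj by (simp add: group_word_simps)
    ultimately show "x \<otimes> z \<otimes> inv x \<in> ?K" using pow subgroup.m_closed[OF K] by simp
  qed
  moreover have "card ?K = p ^ Suc b"
    using card_adjoin[OF finite_carrier H(1) g(1,2) prime_p g(3)] H by simp
  ultimately show ?thesis using that[of ?K] K subset_adjoin(1)[OF H(1) g(1)] by blast
qed

lemma subgroup_between:
  assumes H: "subgroup H G" "card H = p ^ b" "b \<le> c" "c \<le> a"
  obtains K where "subgroup K G" "H \<subseteq> K" "card K = p ^ c" "H \<lhd> G \<Longrightarrow> K \<lhd> G"
proof -
  have "\<exists>K. subgroup K G \<and> H \<subseteq> K \<and> card K = p ^ c \<and> (H \<lhd> G \<longrightarrow> K \<lhd> G)"
    using assms(3,4)
  proof (induction c rule: dec_induct)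
    case base
    thus ?case using H by blast
  next
    case (step c)
    then obtain K where K: "subgroup K G" "H \<subseteq> K" "card K = p ^ c" "H \<lhd> G \<longrightarrow> K \<lhd> G" by auto
    obtain L where "subgroup L G" "K \<subseteq> L" "card L = p ^ Suc c" "K \<lhd> G \<Longrightarrow> L \<lhd> G"
      using extend_subgroup[OF K(1,3)] step.prems by auto
    thus ?case using K by (intro exI[of _ L]) auto
  qed
  thus ?thesis using that by blast
qed

lemma normal_subgroup_of_card:
  assumes "c \<le> a"
  obtains K where "K \<lhd> G" "card K = p ^ c"
proof -
  obtain K where "subgroup K G" "{\<one>} \<subseteq> K" "card K = p ^ c" "{\<one>} \<lhd> G \<Longrightarrow> K \<lhd> G"
    by (rule subgroup_between[OF triv_subgroup, of 0 c]) (use assms in auto)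
  thus ?thesis using that one_is_normal by blast
qed

text \<open>In a finite \<open>p\<close>-group maximal means index \<open>p\<close>. Stating the
  index as a product avoids the truncated \<open>a - 1\<close> and forces
  \<open>a > 0\<close>.\<close>

definition maximal_subgroups :: "'a set set" where
  "maximal_subgroups = {M. subgroup M G \<and> p * card M = p ^ a}"

lemma maximal_subgroups_card:
  assumes "M \<in> maximal_subgroups"
  shows "a > 0" "card M = p ^ (a - 1)"
proof -
  have *: "p * card M = p ^ a" using assms by (simp add: maximal_subgroups_def)
  show "a > 0" using * p_gt_1 by (cases a) auto
  thus "card M = p ^ (a - 1)" using * p_gt_1 by (cases a) auto
qed

lemma maximal_subgroup_adjoin:
  assumes "M \<in> maximal_subgroups"
  obtains g where "g \<in> carrier G" "g [^] p \<in> M" "\<And>x. x \<in> carrier G \<Longrightarrow> commutator g x \<in> M"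
    "adjoin M g = carrier G"
proof -
  have M: "subgroup M G" using assms by (simp add: maximal_subgroups_def)
  have "card M \<noteq> order G" using assms order_eq p_gt_1 by (auto simp: maximal_subgroups_def)
  hence "M \<noteq> carrier G" by (auto simp: order_def)
  then obtain g where g: "g \<in> carrier G" "g \<notin> M" "g [^] p \<in> M"
    and gM: "\<And>x. x \<in> carrier G \<Longrightarrow> commutator g x \<in> M"
    using central_extension_element M by blast
  have "subgroup (adjoin M g) G"
    using adjoin_subgroup[OF finite_carrier M g(1)] commutator_mem_imp_conj_mem[OF M g(1) gM] by blast
  moreover have "card (adjoin M g) = p ^ a"
    using card_adjoin[OF finite_carrier M g(1,2) prime_p g(3)] assms by (simp add: maximal_subgroups_def)
  ultimately have "adjoin M g = carrier G" using card_eq_imp_carrier by blast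
  thus ?thesis using that g gM by blast
qed

text \<open>Every element is \<open>h\<close> in \<open>M\<close> times a power of one
  \<open>g\<close> that normalizes \<open>M\<close>.\<close>

lemma maximal_subgroup_normal:
  assumes "M \<in> maximal_subgroups"
  shows "M \<lhd> G"
proof -
  obtain g where g: "g \<in> carrier G" and "g [^] p \<in> M"
    and gM: "\<And>x. x \<in> carrier G \<Longrightarrow> commutator g x \<in> M"
    and eq: "adjoin M g = carrier G"
    using maximal_subgroup_adjoin[OF assms] by blast
  have M: "subgroup M G" using assms by (simp add: maximal_subgroups_def)
  show ?thesis
    unfolding normal_inv_iff
  proof (intro conjI ballI M)
    fix x k assume x: "x \<in> carrier G" and k: "k \<in> M"
    obtain h j where hj: "h \<in> M" "x = h \<otimes> g [^] (j::nat)" using x unfolding eq[symmetric] by (auto simp: adjoin_def)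
    have c: "h \<in> carrier G" "k \<in> carrier G" using hj k subgroup.mem_carrier[OF M] by blast+
    have "g [^] j \<otimes> k \<otimes> inv (g [^] j) \<in> M"
      using conj_pow_mem[OF M g _ k] commutator_mem_imp_conj_mem[OF M g gM] by blast
    hence "h \<otimes> (g [^] j \<otimes> k \<otimes> inv (g [^] j)) \<otimes> inv h \<in> M"
      using hj M by (simp add: subgroup.m_closed subgroup.m_inv_closed)
    moreover have "x \<otimes> k \<otimes> inv x = h \<otimes> (g [^] j \<otimes> k \<otimes> inv (g [^] j)) \<otimes> inv h"
      using hj c g by (simp add: group_word_simps)
    ultimately show "x \<otimes> k \<otimes> inv x \<in> M" by simp
  qed
qed

text \<open>The quotient by \<open>M\<close> consists of powers of the image of one \<open>g\<close>
  with \<open>g ^ p\<close> in \<open>M\<close>, so it is abelian of exponent dividing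
  \<open>p\<close>.\<close>

lemma maximal_subgroup_contains:
  assumes "M \<in> maximal_subgroups" and x: "x \<in> carrier G"
  shows pow_mem_maximal: "x [^] p \<in> M"
    and commutator_mem_maximal: "y \<in> carrier G \<Longrightarrow> commutator x y \<in> M"
proof -
  obtain g where g: "g \<in> carrier G" "g [^] p \<in> M"
    and "\<And>x. x \<in> carrier G \<Longrightarrow> commutator g x \<in> M" and eq: "adjoin M g = carrier G"
    using maximal_subgroup_adjoin[OF assms(1)] by blast
  have M: "subgroup M G" using assms by (simp add: maximal_subgroups_def)
  obtain Q :: "'a set monoid" and h where hom: "group_hom G Q h"
    and ker: "\<And>x. x \<in> carrier G \<Longrightarrow> h x = \<one>\<^bsub>Q\<^esub> \<longleftrightarrow> x \<in> M"
    using quotient_hom[OF maximal_subgroup_normal[OF assms(1)]] by blast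
  interpret h: group_hom G Q h by (rule hom)
  have pow: "\<exists>j::nat. h z = h g [^]\<^bsub>Q\<^esub> j" if z: "z \<in> carrier G" for z
  proof -
    obtain m j where mj: "m \<in> M" "z = m \<otimes> g [^] (j::nat)" using z unfolding eq[symmetric] by (auto simp: adjoin_def)
    have mc: "m \<in> carrier G" using mj subgroup.mem_carrier[OF M] by blast
    have "h z = h g [^]\<^bsub>Q\<^esub> j" using mj mc ker[OF mc] g by (simp add: h.hom_nat_pow)
    thus ?thesis by blast
  qed
  have "h (g [^] p) = \<one>\<^bsub>Q\<^esub>" using ker g by blast
  hence hg: "h g [^]\<^bsub>Q\<^esub> p = \<one>\<^bsub>Q\<^esub>" using g h.hom_nat_pow by simp
  obtain i :: nat where i: "h x = h g [^]\<^bsub>Q\<^esub> i" using pow x by blast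
  have "h (x [^] p) = (h g [^]\<^bsub>Q\<^esub> p) [^]\<^bsub>Q\<^esub> i"
    using i x g by (simp add: h.hom_nat_pow h.H.nat_pow_pow mult.commute)
  thus "x [^] p \<in> M" using hg ker x by simp
  show "commutator x y \<in> M" if y: "y \<in> carrier G"
  proof -
    obtain j :: nat where j: "h y = h g [^]\<^bsub>Q\<^esub> j" using pow y by blast
    have "h x \<otimes>\<^bsub>Q\<^esub> h y = h y \<otimes>\<^bsub>Q\<^esub> h x"
      unfolding i j using g by (simp add: h.H.nat_pow_mult add.commute)
    hence "h.H.commutator (h x) (h y) = \<one>\<^bsub>Q\<^esub>"
      using h.H.commutator_eq_one_iff[of "h x" "h y"] x y by simp
    hence "h (commutator x y) = \<one>\<^bsub>Q\<^esub>" using h.hom_commutator[OF x y] by simp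
    thus ?thesis using ker[of "commutator x y"] x y by simp
  qed
qed

lemma proper_subset_maximal:
  assumes "subgroup H G" "H \<noteq> carrier G"
  obtains M where "M \<in> maximal_subgroups" "H \<subseteq> M"
proof -
  obtain b where b: "card H = p ^ b" using subgroup_card assms(1) by blast
  have "b < a" using subgroup_card_less assms b by blast
  hence "b \<le> a - 1" "a - 1 \<le> a" by auto
  then obtain M where "subgroup M G" "H \<subseteq> M" "card M = p ^ (a - 1)"
    using subgroup_between[OF assms(1) b] by blast
  moreover have "p * p ^ (a - 1) = p ^ a" using \<open>b < a\<close> by (simp add: power_eq_if)
  ultimately show ?thesis using that[of M] by (simp add: maximal_subgroups_def)
qed

lemma noncyclic_element_in_maximal:
  assumes "\<not> cyclic_group G" "x \<in> carrier G"
  obtains M where "M \<in> maximal_subgroups" "x \<in> M"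
proof -
  have "generate G {x} \<noteq> carrier G"
    using assms cyclic_group generate_pow[OF assms(2)] by (auto simp: full_SetCompr_eq)
  moreover have "subgroup (generate G {x}) G" using generate_is_subgroup assms(2) by blast
  moreover have "x \<in> generate G {x}" by (rule generate.incl) simp
  ultimately show ?thesis using that proper_subset_maximal by blast
qed

text \<open>With \<open>x\<close> in \<open>N\<close> outside \<open>M\<close> and \<open>y\<close>
  in \<open>M\<close> outside \<open>N\<close>, the product of \<open>x\<close> and \<open>y\<close>
  is in neither, yet it does not generate the group, so a third maximal subgroup contains
  it.\<close>

lemma noncyclic_three_maximal:
  assumes "\<not> cyclic_group G"
  obtains M N T where "M \<in> maximal_subgroups" "N \<in> maximal_subgroups" "T \<in> maximal_subgroups"
    "M \<noteq> N" "M \<noteq> T" "N \<noteq> T"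
proof -
  obtain M where M: "M \<in> maximal_subgroups" using noncyclic_element_in_maximal[OF assms one_closed] by blast
  have sM: "subgroup M G" using M by (simp add: maximal_subgroups_def)
  have "card M \<noteq> order G" using M order_eq p_gt_1 by (auto simp: maximal_subgroups_def)
  hence "M \<noteq> carrier G" by (auto simp: order_def)
  then obtain x where x: "x \<in> carrier G" "x \<notin> M" using subgroup.subset[OF sM] by blast
  obtain N where N: "N \<in> maximal_subgroups" "x \<in> N" using noncyclic_element_in_maximal[OF assms x(1)] by blast
  have sN: "subgroup N G" using N by (simp add: maximal_subgroups_def)
  have "\<not> M \<subseteq> N"
    using card_subset_eq[OF finite_subgroup[OF sN], of M] maximal_subgroups_card M N x by auto
  then obtain y where y: "y \<in> M" "y \<notin> N" by blast
  have yc: "y \<in> carrier G" using y subgroup.mem_carrier[OF sM] by blast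
  obtain T where T: "T \<in> maximal_subgroups" "x \<otimes> y \<in> T"
    using noncyclic_element_in_maximal[OF assms m_closed[OF x(1) yc]] by blast
  have "x \<otimes> y \<notin> M"
  proof
    assume "x \<otimes> y \<in> M"
    hence "x \<otimes> y \<otimes> inv y \<in> M" using y sM by (simp add: subgroup.m_closed subgroup.m_inv_closed)
    thus False using x yc by (simp add: group_word_simps)
  qed
  moreover have "x \<otimes> y \<notin> N"
  proof
    assume "x \<otimes> y \<in> N"
    hence "inv x \<otimes> (x \<otimes> y) \<in> N" using N sN by (simp add: subgroup.m_closed subgroup.m_inv_closed)
    thus False using x y yc by (simp add: group_word_simps)
  qed
  ultimately show ?thesis using that[of M N T] M N T x by blast
qed

lemma noncyclic_exponent_ge_2:
  assumes "\<not> cyclic_group G"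
  shows "a \<ge> 2"
proof -
  obtain M N T where MN: "M \<in> maximal_subgroups" "N \<in> maximal_subgroups" "M \<noteq> N"
    using noncyclic_three_maximal[OF assms] by blast
  have "a \<noteq> 1"
  proof
    assume "a = 1"
    hence "card M = 1" "card N = 1" using MN maximal_subgroups_card by auto
    moreover have "\<one> \<in> M" "\<one> \<in> N" using MN subgroup.one_closed by (auto simp: maximal_subgroups_def)
    ultimately show False using MN(3) by (metis card_1_singletonE singletonD)
  qed
  thus ?thesis using maximal_subgroups_card(1) MN by fastforce
qed

text \<open>The derived subgroup lies in two different maximal subgroups, so the first step loses a
  factor \<open>p ^ 2\<close>; each later strict step loses at least \<open>p\<close>.\<close>

lemma noncyclic_lower_central_card:
  assumes "\<not> cyclic_group G" "i \<ge> 1"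
  shows "lower_central G i = {\<one>} \<or> card (lower_central G i) \<le> p ^ (a - Suc i)"
  using assms(2)
proof (induction i rule: dec_induct)
  case base
  obtain M N T where MN: "M \<in> maximal_subgroups" "N \<in> maximal_subgroups" "M \<noteq> N"
    using noncyclic_three_maximal[OF assms(1)] by blast
  have s: "subgroup M G" "subgroup N G" using MN by (auto simp: maximal_subgroups_def)
  have "lower_central G 1 \<subseteq> M \<inter> N"
    using commutator_mem_maximal MN s unfolding One_nat_def lower_central.simps
    by (intro commutator_subgroup_subset subgroups_Inter_pair) auto
  moreover have "M \<inter> N \<subset> M"
    using card_subset_eq[OF finite_subgroup[OF s(2)], of M] maximal_subgroups_card MN by auto
  ultimately have psub: "lower_central G 1 \<subset> M" by blast
  obtain b where b: "card (lower_central G 1) = p ^ b" using subgroup_card lower_central_is_subgroup by blast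
  have "p ^ b < p ^ (a - 1)"
    using psubset_card_mono[OF finite_subgroup[OF s(1)] psub] b maximal_subgroups_card MN by metis
  hence "b \<le> a - 2" using p_gt_1 by simp
  thus ?case using b p_gt_1 by (simp add: numeral_2_eq_2)
next
  case (step i)
  show ?case
  proof (cases "lower_central G i = {\<one>}")
    case True
    thus ?thesis using lower_central_Suc_subset[of i] subgroup.one_closed[OF lower_central_is_subgroup] by blast
  next
    case False
    have "lower_central G (Suc i) \<subset> lower_central G i"
      using nilpotent_lower_central_strict[OF nilpotent False] .
    hence lt: "card (lower_central G (Suc i)) < card (lower_central G i)"
      using psubset_card_mono finite_subgroup lower_central_is_subgroup by blast
    obtain b where b: "card (lower_central G (Suc i)) = p ^ b" using subgroup_card lower_central_is_subgroup by blast
    have "p ^ b < p ^ (a - Suc i)" using lt b step False by auto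
    hence "b \<le> a - Suc (Suc i)" using p_gt_1 by simp
    thus ?thesis using b p_gt_1 by simp
  qed
qed

text \<open>At \<open>i = a - 1\<close> the cardinality bound is \<open>p ^ 0\<close>.\<close>

lemma noncyclic_lower_central_trivial:
  assumes "\<not> cyclic_group G"
  shows "lower_central G (a - 1) = {\<one>}"
proof -
  have a: "a \<ge> 2" using noncyclic_exponent_ge_2[OF assms] .
  have "card (lower_central G (a - 1)) \<le> 1 \<or> lower_central G (a - 1) = {\<one>}"
    using noncyclic_lower_central_card[OF assms, of "a - 1"] a by auto
  moreover have "finite (lower_central G (a - 1))" "\<one> \<in> lower_central G (a - 1)"
    using finite_subgroup subgroup.one_closed lower_central_is_subgroup by auto
  ultimately show ?thesis
    by (metis card_le_Suc0_iff_eq One_nat_def is_singletonI' is_singleton_the_elem empty_iff singletonD)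
qed

end

section \<open>Subgroups of noncyclic p-groups\<close>

context group
begin

lemma cyclic_subgroup_generator:
  assumes "subgroup H G" "cyclic_group (G\<lparr>carrier := H\<rparr>)"
  obtains x where "x \<in> H" "x \<in> carrier G" "H = generate G {x}"
proof -
  interpret H: group "G\<lparr>carrier := H\<rparr>" using assms(1) by (rule subgroup_imp_group)
  obtain x where x: "x \<in> H" "H = range (\<lambda>n::int. x [^]\<^bsub>G\<lparr>carrier := H\<rparr>\<^esub> n)"
    using assms(2) H.cyclic_group by auto
  have xc: "x \<in> carrier G" using x(1) subgroup.mem_carrier[OF assms(1)] by blast
  have "H = range (\<lambda>n::int. x [^] n)"
    using x(2) int_pow_consistent[OF assms(1) x(1)] by simp
  thus ?thesis using that[of x] x(1) xc generate_pow[OF xc] by (simp add: full_SetCompr_eq)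
qed

lemma finite_generate_nat_pow:
  assumes fin: "finite (carrier G)" and x: "x \<in> carrier G" and z: "z \<in> generate G {x}"
  obtains n :: nat where "z = x [^] n"
proof -
  obtain k :: int where k: "z = x [^] k" using z generate_pow[OF x] by auto
  have o: "order G > 0" using fin by (simp add: order_gt_0_iff_finite)
  have "x [^] k = x [^] (int (order G) * (k div int (order G)) + k mod int (order G))" by simp
  also have "\<dots> = (x [^] int (order G)) [^] (k div int (order G)) \<otimes> x [^] (k mod int (order G))"
    using x by (simp only: int_pow_mult int_pow_pow)
  also have "x [^] int (order G) = \<one>" using pow_order_eq_1[OF x] by (simp only: int_pow_int)
  also have "x [^] (k mod int (order G)) = x [^] nat (k mod int (order G))"
    using o by (metis int_pow_int nat_0_le of_nat_0_less_iff pos_mod_sign)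
  finally show ?thesis using that k x by simp
qed

lemma generate_singleton_commute:
  assumes fin: "finite (carrier G)" and x: "x \<in> carrier G" and "u \<in> generate G {x}" "v \<in> generate G {x}"
  shows "u \<otimes> v = v \<otimes> u"
proof -
  obtain m n :: nat where "u = x [^] m" "v = x [^] n"
    using finite_generate_nat_pow assms by metis
  thus ?thesis using x by (simp add: nat_pow_mult add.commute)
qed

end

context nilpotent_p_group
begin

text \<open>Pick generators \<open>x\<close>, \<open>y\<close> of two maximal subgroups with \<open>x\<^sup>p = y\<^bsup>pj\<^esup>\<close>; then \<open>x y\<^bsup>-j\<^esup>\<close> lies
  outside \<open>\<langle>y\<rangle>\<close> but has order dividing \<open>p\<^sup>2\<close>, which a cyclic maximal subgroup only allows
  when it has order at most \<open>p\<^sup>2\<close>.\<close>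
lemma all_maximal_cyclic_imp_small:
  assumes nc: "\<not> cyclic_group G"
    and cyc: "\<And>M. M \<in> maximal_subgroups \<Longrightarrow> cyclic_group (G\<lparr>carrier := M\<rparr>)"
  shows "a \<le> 3"
proof (rule ccontr)
  assume "\<not> a \<le> 3"
  hence a: "a \<ge> 4" by simp
  obtain M N T where MN: "M \<in> maximal_subgroups" "N \<in> maximal_subgroups" "M \<noteq> N"
    using noncyclic_three_maximal[OF nc] by blast
  have sub: "subgroup H G" if "H \<in> maximal_subgroups" for H
    using that by (simp add: maximal_subgroups_def)
  have fin: "finite H" if "H \<in> maximal_subgroups" for H
    using finite_subgroup sub that by blast
  have not_sub: "\<not> H \<subseteq> K" if "H \<in> maximal_subgroups" "K \<in> maximal_subgroups" "H \<noteq> K" for H K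
    using card_subset_eq[OF fin[OF that(2)], of H] maximal_subgroups_card(2) that by auto
  have gen_notin: "x \<notin> K"
    if "H \<in> maximal_subgroups" "K \<in> maximal_subgroups" "H \<noteq> K" "H = generate G {x}" for H K x
    using not_sub[OF that(1-3)] generate_subgroup_incl[of "{x}" K] sub[OF that(2)] that(4) by blast
  obtain x where x: "x \<in> M" "x \<in> carrier G" "M = generate G {x}"
    using cyclic_subgroup_generator[OF sub cyc] MN by blast
  obtain y where y: "y \<in> N" "y \<in> carrier G" "N = generate G {y}"
    using cyclic_subgroup_generator[OF sub cyc] MN by blast
  have xN: "x \<notin> N" and yM: "y \<notin> M"
    using gen_notin[OF MN x(3)] gen_notin[OF MN(2,1) _ y(3)] MN(3) by auto
  have Mcomm: "u \<otimes> v = v \<otimes> u" if "u \<in> M" "v \<in> M" for u v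
    using generate_singleton_commute[OF finite_carrier x(2)] that x(3) by blast
  have Ncomm: "u \<otimes> v = v \<otimes> u" if "u \<in> N" "v \<in> N" for u v
    using generate_singleton_commute[OF finite_carrier y(2)] that y(3) by blast
  have xpM: "x [^] p \<in> M" using pow_mem_maximal MN x by blast
  have xpN: "x [^] p \<in> N" using pow_mem_maximal MN x by blast
  obtain s :: nat where s: "x [^] p = y [^] s"
    using finite_generate_nat_pow[OF finite_carrier y(2)] xpN y(3) by blast
  \<comment> \<open>Otherwise \<open>y ^ p\<close> and \<open>y ^ s\<close>, both in
    \<open>M\<close>, would force \<open>y\<close> into \<open>M\<close>.\<close>
  have "p dvd s"
  proof (rule ccontr)
    assume "\<not> p dvd s"
    hence "coprime p s" using prime_p prime_imp_coprime by blast
    moreover have "y [^] p \<in> M" using pow_mem_maximal MN y by blast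
    moreover have "y [^] s \<in> M" using s xpM by simp
    ultimately show False using coprime_pow_mem[OF sub[OF MN(1)] y(2)] yM by blast
  qed
  then obtain j where j: "s = p * j" by blast
  \<comment> \<open>Chosen so that \<open>x ^ p\<close> and \<open>v ^ p\<close> cancel;
    \<open>w\<close> below is \<open>x\<close> corrected by an element of \<open>N\<close>.\<close>
  define v where "v = inv (y [^] j)"
  have vc: "v \<in> carrier G" using y by (simp add: v_def)
  have "y [^] j \<in> N"
    by (induction j) (use y sub[OF MN(2)] in \<open>simp_all add: subgroup.one_closed subgroup.m_closed\<close>)
  hence vN: "v \<in> N" unfolding v_def using subgroup.m_inv_closed[OF sub[OF MN(2)]] by blast
  have vp: "v [^] p = inv (x [^] p)"
    using s j y by (simp add: v_def nat_pow_inv nat_pow_pow mult.commute)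
  define c where "c = commutator v x"
  have cc: "c \<in> carrier G" using x vc by (simp add: c_def)
  \<comment> \<open>The maximal subgroups \<open>M\<close> and \<open>N\<close> are abelian, so
    \<open>c\<close> commutes with both \<open>x\<close> and \<open>v\<close>, and the class two
    power formula applies.\<close>
  have cM: "c \<in> M" and cN: "c \<in> N"
    unfolding c_def using commutator_mem_maximal MN vc x(2) by blast+
  have vx: "v \<otimes> x = c \<otimes> (x \<otimes> v)" using x vc by (simp add: c_def group_word_simps)
  have cx: "c \<otimes> x = x \<otimes> c" using Mcomm cM x by blast
  have cv: "c \<otimes> v = v \<otimes> c" using Ncomm cN vN by blast
  have "v [^] p \<in> M" using pow_mem_maximal MN vc by blast
  hence "v [^] p \<otimes> x = x \<otimes> v [^] p" using Mcomm x by blast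
  hence cp: "c [^] p = \<one>" using commutator_pow_eq_one[OF c_def cv vc x(2)] by blast
  define w where "w = x \<otimes> v"
  have wc: "w \<in> carrier G" using x vc by (simp add: w_def)
  \<comment> \<open>The exponent \<open>p ^ 2\<close> rather than \<open>p\<close> is taken because
    of \<open>p = 2\<close>: there \<open>p * (p - 1) div 2\<close> is 1, which \<open>p\<close>
    does not divide.\<close>
  have "p ^ 2 * (p ^ 2 - 1) div 2 = p * (p * (p ^ 2 - 1) div 2)"
  proof -
    have "even (p * (p ^ 2 - 1))" using p_gt_1 by (cases "even p") auto
    hence "p * (p * (p ^ 2 - 1) div 2) = p * (p * (p ^ 2 - 1)) div 2" by (rule div_mult_swap)
    thus ?thesis by (simp add: power2_eq_square mult.assoc)
  qed
  hence "c [^] (p ^ 2 * (p ^ 2 - 1) div 2) = (c [^] p) [^] (p * (p ^ 2 - 1) div 2)"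
    using cc by (simp only: nat_pow_pow)
  hence c1: "c [^] (p ^ 2 * (p ^ 2 - 1) div 2) = \<one>" using cp by simp
  have "v [^] (p ^ 2) = inv (x [^] (p ^ 2))"
  proof -
    have "v [^] (p ^ 2) = (v [^] p) [^] p" using vc by (simp add: nat_pow_pow power2_eq_square)
    also have "\<dots> = inv ((x [^] p) [^] p)" using vp x by (simp add: nat_pow_inv)
    finally show ?thesis using x by (simp add: nat_pow_pow power2_eq_square)
  qed
  hence w2: "w [^] (p ^ 2) = \<one>"
    using mult_pow_commuting_commutator[OF vx cx cv x(2) vc cc, of "p ^ 2"] c1 x by (simp add: w_def)
  have wN: "w \<notin> N"
  proof
    assume "w \<in> N"
    hence "w \<otimes> inv v \<in> N" using vN sub[OF MN(2)] by (simp add: subgroup.m_closed subgroup.m_inv_closed)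
    thus False using xN x vc by (simp add: w_def group_word_simps)
  qed
  obtain W where W: "W \<in> maximal_subgroups" "w \<in> W" using noncyclic_element_in_maximal[OF nc wc] by blast
  obtain u where u: "u \<in> W" "u \<in> carrier G" "W = generate G {u}"
    using cyclic_subgroup_generator[OF sub cyc] W by blast
  obtain s' :: nat where s': "w = u [^] s'"
    using finite_generate_nat_pow[OF finite_carrier u(2)] W u(3) by blast
  have ordu: "ord u = p ^ (a - 1)"
    using generate_pow_card[OF u(2)] u(3) maximal_subgroups_card(2)[OF W(1)] by simp
  \<comment> \<open>Here \<open>a \<ge> 4\<close> enters: the order of \<open>w\<close> divides
    \<open>p ^ (a - 2)\<close>, so \<open>w\<close> is not a generator of the cyclic group
    \<open>W\<close> of order \<open>p ^ (a - 1)\<close>.\<close>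
  have "w [^] (p ^ 2 * p ^ (a - 4)) = \<one>" using w2 wc by (simp add: nat_pow_pow[symmetric])
  moreover have "p ^ 2 * p ^ (a - 4) = p ^ (a - 2)"
  proof -
    have "2 + (a - 4) = a - 2" using a by simp
    thus ?thesis using power_add[of p 2 "a - 4"] by metis
  qed
  ultimately have "u [^] (s' * p ^ (a - 2)) = \<one>" using s' u by (simp add: nat_pow_pow)
  hence "p ^ (a - 1) dvd s' * p ^ (a - 2)" using pow_eq_id[OF u(2)] ordu by metis
  moreover have "p ^ (a - 1) = p * p ^ (a - 2)" 
  proof -
    have "a - 1 = Suc (a - 2)" using a by simp
    thus ?thesis by simp
  qed
  ultimately have "p dvd s'" using p_gt_1 by simp
  then obtain t where "s' = p * t" by blast
  hence wt: "w = (u [^] p) [^] t" using s' u by (simp add: nat_pow_pow)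
  \<comment> \<open>Being a power of \<open>u ^ p\<close>, the element \<open>w\<close> would lie in
    every maximal subgroup, in particular in \<open>N\<close>.\<close>
  have "u [^] p \<in> N" using pow_mem_maximal MN u by blast
  hence "(u [^] p) [^] t \<in> N"
    by (induction t) (use sub[OF MN(2)] in \<open>simp_all add: subgroup.one_closed subgroup.m_closed\<close>)
  thus False using wN wt by simp
qed

end

text \<open>Outside the locale, because the induction replaces the group by a noncyclic maximal
  subgroup. If \<open>i < a - 1\<close>, then \<open>2 \<le> i\<close> makes \<open>a\<close> at
  least 4, so such a subgroup exists.\<close>

lemma noncyclic_two_subgroups:
  assumes "nilpotent_p_group G p a" "\<not> cyclic_group G" "2 \<le> i" "i < a"
  shows "\<exists>K L. subgroup K G \<and> subgroup L G \<and> card K = p ^ i \<and> card L = p ^ i \<and> K \<noteq> L"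
  using assms
proof (induction a arbitrary: G rule: less_induct)
  case (less a)
  interpret nilpotent_p_group G p a by fact
  show ?case
  proof (cases "i = a - 1")
    case True
    obtain M N T where "M \<in> maximal_subgroups" "N \<in> maximal_subgroups" "M \<noteq> N"
      using noncyclic_three_maximal[OF less.prems(2)] by blast
    thus ?thesis using True maximal_subgroups_card(2) unfolding maximal_subgroups_def by blast
  next
    case False
    hence i: "i < a - 1" using less.prems by simp
    have "\<not> a \<le> 3" using i less.prems by simp
    then obtain M where M: "M \<in> maximal_subgroups" "\<not> cyclic_group (G\<lparr>carrier := M\<rparr>)"
      using all_maximal_cyclic_imp_small[OF less.prems(2)] by blast
    have sM: "subgroup M G" using M by (simp add: maximal_subgroups_def)
    have pM: "nilpotent_p_group (G\<lparr>carrier := M\<rparr>) p (a - 1)"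
      using subgroup_nilpotent_p_group[OF sM maximal_subgroups_card(2)[OF M(1)]] .
    obtain K L where KL: "subgroup K (G\<lparr>carrier := M\<rparr>)" "subgroup L (G\<lparr>carrier := M\<rparr>)"
      "card K = p ^ i" "card L = p ^ i" "K \<noteq> L"
      using less.IH[OF _ pM M(2) less.prems(3) i] i by auto
    thus ?thesis using incl_subgroup[OF sM] by blast
  qed
qed

context nilpotent_p_group
begin

text \<open>The orders \<open>p ^ i\<close> with \<open>2 \<le> i < a\<close> contribute a normal
  \<open>N i\<close> and another \<open>K i\<close>; the trivial group, \<open>L\<close> of order
  \<open>p\<close>, the whole group and a further maximal \<open>T\<close> add four. Only the
  \<open>K i\<close> may fail to be normal, one per order, so distinct members cannot be
  conjugate.\<close>

lemma noncyclic_nonconjugate_family: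
  assumes nc: "\<not> cyclic_group G"
  obtains F where "finite F" "card F = 2 * a" "\<And>A. A \<in> F \<Longrightarrow> subgroup A G"
    "\<And>A B. A \<in> F \<Longrightarrow> B \<in> F \<Longrightarrow> card A = card B \<Longrightarrow> A \<noteq> B \<Longrightarrow> A \<lhd> G \<or> B \<lhd> G"
proof -
  have a: "a \<ge> 2" using noncyclic_exponent_ge_2[OF nc] .
  have inj: "p ^ i = p ^ j \<longleftrightarrow> i = j" for i j using p_gt_1 by simp
  have "\<forall>i\<in>{2..<a}. \<exists>N K. N \<lhd> G \<and> subgroup K G \<and> card N = p ^ i \<and> card K = p ^ i \<and> N \<noteq> K"
  proof
    fix i assume i: "i \<in> {2..<a}"
    obtain N where N: "N \<lhd> G" "card N = p ^ i" using normal_subgroup_of_card[of i] i by auto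
    obtain K L where "subgroup K G" "subgroup L G" "card K = p ^ i" "card L = p ^ i" "K \<noteq> L"
      using noncyclic_two_subgroups[OF nilpotent_p_group_axioms nc, of i] i by auto
    thus "\<exists>N K. N \<lhd> G \<and> subgroup K G \<and> card N = p ^ i \<and> card K = p ^ i \<and> N \<noteq> K"
      using N by metis
  qed
  from bchoice[OF this] obtain N where
    "\<forall>i\<in>{2..<a}. \<exists>K. N i \<lhd> G \<and> subgroup K G \<and> card (N i) = p ^ i \<and> card K = p ^ i \<and> N i \<noteq> K" ..
  from bchoice[OF this] obtain K where NK: "\<And>i. i \<in> {2..<a} \<Longrightarrow> N i \<lhd> G" "\<And>i. i \<in> {2..<a} \<Longrightarrow> subgroup (K i) G"
    "\<And>i. i \<in> {2..<a} \<Longrightarrow> card (N i) = p ^ i" "\<And>i. i \<in> {2..<a} \<Longrightarrow> card (K i) = p ^ i"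
    "\<And>i. i \<in> {2..<a} \<Longrightarrow> N i \<noteq> K i"
    by blast
  obtain L where L: "L \<lhd> G" "card L = p ^ 1" using normal_subgroup_of_card[of 1] a by auto
  \<comment> \<open>For \<open>a = 2\<close> maximal subgroups have the order of \<open>L\<close>
    and there are no \<open>N i\<close>, \<open>K i\<close>; otherwise the two to avoid have index
    \<open>a - 1\<close>. Three maximal subgroups suffice in both cases.\<close>
  obtain T where T: "T \<in> maximal_subgroups" "T \<notin> (if a = 2 then {L} else {N (a - 1), K (a - 1)})"
  proof -
    obtain M1 M2 M3 where "M1 \<in> maximal_subgroups" "M2 \<in> maximal_subgroups" "M3 \<in> maximal_subgroups"
      "M1 \<noteq> M2" "M1 \<noteq> M3" "M2 \<noteq> M3" using noncyclic_three_maximal[OF nc] .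
    thus ?thesis using that by (cases "a = 2"; simp; metis)
  qed
  have cT: "card T = p ^ (a - 1)" using maximal_subgroups_card(2)[OF T(1)] .
  have nT: "T \<lhd> G" using maximal_subgroup_normal[OF T(1)] .
  have cG: "card (carrier G) = p ^ a" using order_eq by (simp add: order_def)
  let ?A = "N ` {2..<a}" and ?B = "K ` {2..<a}" and ?C = "{{\<one>}, L, carrier G, T}"
  have injN: "inj_on N {2..<a}" and injK: "inj_on K {2..<a}"
    by (rule inj_onI, metis NK(3) inj) (rule inj_onI, metis NK(4) inj)
  have "N i \<noteq> K j" if "i \<in> {2..<a}" "j \<in> {2..<a}" for i j
    using NK(3)[OF that(1)] NK(4)[OF that(2)] NK(5)[OF that(1)] inj by metis
  hence AB: "?A \<inter> ?B = {}" by blast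
  have exT: "T \<noteq> N i" "T \<noteq> K i" if i: "i \<in> {2..<a}" for i
  proof -
    have "card (N i) \<noteq> card T \<and> card (K i) \<noteq> card T" if "i \<noteq> a - 1"
      using NK(3,4)[OF i] that cT inj by simp
    moreover have "T \<noteq> N (a - 1)" "T \<noteq> K (a - 1)" using T(2) i by auto
    ultimately show "T \<noteq> N i" "T \<noteq> K i" by auto
  qed
  have ABC: "(?A \<union> ?B) \<inter> ?C = {}"
  proof -
    have "S \<notin> ?C" if S: "S = N i \<or> S = K i" and i: "i \<in> {2..<a}" for S i
    proof -
      have cS: "card S = p ^ i" using S NK(3,4)[OF i] by auto
      have "card S \<noteq> card {\<one>}" "card S \<noteq> card L" "card S \<noteq> card (carrier G)"
        using i p_gt_1 inj[of i 0] unfolding cS L(2) cG inj by auto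
      moreover have "S \<noteq> T" using exT[OF i] S by auto
      ultimately show ?thesis by auto
    qed
    thus ?thesis by blast
  qed
  have cC: "card ?C = 4"
  proof -
    have neq: "S \<noteq> S'" if "card S = p ^ i" "card S' = p ^ j" "i \<noteq> j" for S S' :: "'a set" and i j
      using that inj by metis
    have "card {\<one>} = p ^ 0" by simp
    note neq[OF this L(2)] neq[OF this cG] neq[OF this cT] neq[OF L(2) cG] neq[OF cT cG]
    hence "{\<one>} \<noteq> L" "{\<one>} \<noteq> carrier G" "{\<one>} \<noteq> T" "L \<noteq> carrier G" "T \<noteq> carrier G"
      using a by simp_all
    moreover have "L \<noteq> T"
    proof (cases "a = 2")
      case True thus ?thesis using T by auto
    next
      case False
      thus ?thesis using neq[OF L(2) cT] a by simp
    qed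
    ultimately show ?thesis by auto
  qed
  let ?F = "?A \<union> ?B \<union> ?C"
  show ?thesis
  proof
    show "finite ?F" by auto
    have "card ?F = card ?A + card ?B + card ?C"
      using AB ABC by (subst card_Un_disjoint; simp add: card_Un_disjoint)
    thus "card ?F = 2 * a" using cC card_image[OF injN] card_image[OF injK] a by simp
    have normal: "A \<lhd> G" if "A \<in> ?F" "A \<notin> ?B" for A
      using that NK(1) one_is_normal L(1) normal_self nT by auto
    show "subgroup A G" if "A \<in> ?F" for A
      using normal[OF that] NK(2) normal_imp_subgroup by (cases "A \<in> ?B") auto
    show "A \<lhd> G \<or> B \<lhd> G" if "A \<in> ?F" "B \<in> ?F" "card A = card B" "A \<noteq> B" for A B
    proof (rule ccontr)
      assume "\<not> (A \<lhd> G \<or> B \<lhd> G)"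
      hence "A \<in> ?B" "B \<in> ?B" using normal that(1,2) by blast+
      then obtain i j where "i \<in> {2..<a}" "j \<in> {2..<a}" "A = K i" "B = K j" by blast
      thus False using NK(4)[of i] NK(4)[of j] inj that by simp
    qed
  qed
qed

end

section \<open>Sylow and Hall subgroups of nilpotent groups\<close>

context group
begin

section \<open>Products of subgroups and elements of coprime order\<close>

lemma subgroup_pow_card:
  assumes "subgroup H G" "x \<in> H"
  shows "x [^] card H = \<one>"
proof -
  interpret H: group "G\<lparr>carrier := H\<rparr>" using assms(1) by (rule subgroup_imp_group)
  have "x [^]\<^bsub>G\<lparr>carrier := H\<rparr>\<^esub> order (G\<lparr>carrier := H\<rparr>) = \<one>"
    using H.pow_order_eq_1[of x] assms(2) by simp
  thus ?thesis using nat_pow_consistent[of x] by (simp add: order_def)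
qed

lemma commuting_subgroups_set_mult:
  assumes A: "subgroup A G" and B: "subgroup B G"
    and comm: "\<And>x y. x \<in> A \<Longrightarrow> y \<in> B \<Longrightarrow> x \<otimes> y = y \<otimes> x"
  shows "subgroup (A <#> B) G"
proof (rule subgroupI)
  note Ac = subgroup.mem_carrier[OF A] and Bc = subgroup.mem_carrier[OF B]
  show "A <#> B \<subseteq> carrier G" using Ac Bc by (auto simp: set_mult_def)
  show "A <#> B \<noteq> {}" using subgroup.one_closed[OF A] subgroup.one_closed[OF B] by (auto simp: set_mult_def)
  fix u assume "u \<in> A <#> B"
  then obtain x y where u: "u = x \<otimes> y" "x \<in> A" "y \<in> B" by (auto simp: set_mult_def)
  have "inv u = inv x \<otimes> inv y"
    using u comm[of x y] Ac Bc by (simp add: inv_mult_group)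
  thus "inv u \<in> A <#> B"
    using u subgroup.m_inv_closed[OF A] subgroup.m_inv_closed[OF B] by (auto simp: set_mult_def)
  fix w assume "w \<in> A <#> B"
  then obtain x' y' where w: "w = x' \<otimes> y'" "x' \<in> A" "y' \<in> B" by (auto simp: set_mult_def)
  have "u \<otimes> w = x \<otimes> ((y \<otimes> x') \<otimes> y')" using u w Ac Bc by (simp add: m_assoc)
  also have "y \<otimes> x' = x' \<otimes> y" using comm[of x' y] u w by simp
  also have "x \<otimes> ((x' \<otimes> y) \<otimes> y') = (x \<otimes> x') \<otimes> (y \<otimes> y')" using u w Ac Bc by (simp add: m_assoc)
  finally have eq: "u \<otimes> w = (x \<otimes> x') \<otimes> (y \<otimes> y')" .
  show "u \<otimes> w \<in> A <#> B"
    unfolding set_mult_def eq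
    by (rule UN_I[OF subgroup.m_closed[OF A u(2) w(2)]], rule UN_I[OF subgroup.m_closed[OF B u(3) w(3)]]) simp
qed

lemma card_set_mult_coprime:
  assumes A: "subgroup A G" and B: "subgroup B G" and "coprime (card A) (card B)"
  shows "card (A <#> B) = card A * card B"
proof -
  note Ac = subgroup.mem_carrier[OF A] and Bc = subgroup.mem_carrier[OF B]
  have "A <#> B = (\<lambda>(x, y). x \<otimes> y) ` (A \<times> B)" by (auto simp: set_mult_def)
  moreover have "inj_on (\<lambda>(x, y). x \<otimes> y) (A \<times> B)"
  proof (rule inj_onI)
    fix u w assume uw: "u \<in> A \<times> B" "w \<in> A \<times> B" "(case u of (x, y) \<Rightarrow> x \<otimes> y) = (case w of (x, y) \<Rightarrow> x \<otimes> y)"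
    obtain x y x' y' where xy: "u = (x, y)" "w = (x', y')" by (cases u, cases w)
    have mem: "x \<in> A" "x' \<in> A" "y \<in> B" "y' \<in> B" and eq: "x \<otimes> y = x' \<otimes> y'" using uw unfolding xy by auto
    have c: "x \<in> carrier G" "x' \<in> carrier G" "y \<in> carrier G" "y' \<in> carrier G" using mem Ac Bc by auto
    define z where "z = inv x' \<otimes> x"
    have "z \<otimes> y = y'" unfolding z_def using eq c by (simp add: group_word_simps)
    hence "z = y' \<otimes> inv y" using c z_def by (metis inv_solve_right inv_closed m_closed)
    hence zB: "z \<in> B" using mem B by (simp add: subgroup.m_closed subgroup.m_inv_closed)
    have zA: "z \<in> A" unfolding z_def using mem A by (simp add: subgroup.m_closed subgroup.m_inv_closed)
    have "z = \<one>"
      using pow_coprime_eq_one[OF Ac[OF zA] subgroup_pow_card[OF A zA] subgroup_pow_card[OF B zB]] assms(3) .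
    hence "x = x'" unfolding z_def using c by (metis inv_equality inv_inv inv_closed)
    moreover from this have "y = y'" using eq c by simp
    ultimately show "u = w" using xy by simp
  qed
  ultimately show ?thesis by (simp add: card_image card_cartesian_product)
qed

lemma ord_mult_coprime:
  assumes x: "x \<in> carrier G" "y \<in> carrier G" and comm: "x \<otimes> y = y \<otimes> x" and cop: "coprime (ord x) (ord y)"
  shows "ord (x \<otimes> y) = ord x * ord y"
proof (rule dvd_antisym)
  show "ord (x \<otimes> y) dvd ord x * ord y" using ord_mul_divides x comm by blast
  let ?k = "ord (x \<otimes> y)"
  have eq: "x [^] ?k \<otimes> y [^] ?k = \<one>" using pow_mult_distrib[OF comm x, of ?k] x by simp
  hence inv: "x [^] ?k = inv (y [^] ?k)" using x by (metis inv_equality nat_pow_closed)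
  have "(x [^] ?k) [^] ord x = (x [^] ord x) [^] ?k" using x by (simp only: nat_pow_pow mult.commute)
  hence "(x [^] ?k) [^] ord x = \<one>" using x by simp
  moreover have "(x [^] ?k) [^] ord y = \<one>"
  proof -
    have "(y [^] ?k) [^] ord y = (y [^] ord y) [^] ?k" using x by (simp only: nat_pow_pow mult.commute)
    hence "(y [^] ?k) [^] ord y = \<one>" using x by simp
    thus ?thesis unfolding inv using x by (simp add: nat_pow_inv del: nat_pow_pow)
  qed
  ultimately have xk: "x [^] ?k = \<one>" using pow_coprime_eq_one[of "x [^] ?k"] x cop by simp
  hence "y [^] ?k = \<one>" using eq x by simp
  hence "ord x dvd ?k" "ord y dvd ?k" using xk pow_eq_id x by auto
  thus "ord x * ord y dvd ?k" using cop divides_mult by blast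
qed

lemma cyclic_groupI_ord:
  assumes "finite (carrier G)" "x \<in> carrier G" "ord x = order G"
  shows "cyclic_group G"
proof -
  have "card (generate G {x}) = card (carrier G)"
    using generate_pow_card[OF assms(2)] assms(3) by (simp add: order_def)
  hence "generate G {x} = carrier G"
    using card_subset_eq[OF assms(1)] generate_incl[of "{x}"] assms(2) by simp
  thus ?thesis using cyclic_group generate_pow[OF assms(2)] assms(2) by (auto simp: full_SetCompr_eq)
qed

end

locale finite_nilpotent_group = group G for G (structure) +
  assumes finite_carrier: "finite (carrier G)" and nilpotent: "nilpotent_group G"
begin

abbreviation sylow_card :: "nat \<Rightarrow> nat" where
  "sylow_card q \<equiv> q ^ multiplicity q (order G)"

lemma order_pos: "order G > 0"
  using finite_carrier by (simp add: order_gt_0_iff_finite)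

lemma coprime_subgroups_commute:
  assumes "subgroup A G" "subgroup B G" "coprime (card A) (card B)" "x \<in> A" "y \<in> B"
  shows "x \<otimes> y = y \<otimes> x"
  by (rule nilpotent_coprime_commute[OF nilpotent _ _ subgroup_pow_card[OF assms(1,4)] subgroup_pow_card[OF assms(2,5)] assms(3)])
     (use subgroup.mem_carrier[OF assms(1) assms(4)] subgroup.mem_carrier[OF assms(2) assms(5)] in auto)

lemma coprime_subgroups_set_mult:
  assumes "subgroup A G" "subgroup B G" "coprime (card A) (card B)"
  shows "subgroup (A <#> B) G"
  using commuting_subgroups_set_mult[OF assms(1,2)] coprime_subgroups_commute[OF assms] by blast

lemma coprime_sylow_card_prod:
  assumes "S \<subseteq> prime_factors (order G)" "q \<in> prime_factors (order G)" "q \<notin> S"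
  shows "coprime (sylow_card q) (\<Prod>r\<in>S. sylow_card r)"
proof (rule prod_coprime_right)
  fix r assume r: "r \<in> S"
  have "Factorial_Ring.prime q" "Factorial_Ring.prime r" "q \<noteq> r" using assms r by auto
  hence "coprime q r" by (rule primes_coprime)
  thus "coprime (sylow_card q) (sylow_card r)" by simp
qed

lemma sylow_subgroup_exists:
  assumes "Factorial_Ring.prime q"
  shows "\<exists>P. subgroup P G \<and> card P = sylow_card q"
proof -
  obtain m where "order G = sylow_card q * m" using multiplicity_dvd[of q "order G"] by blast
  thus ?thesis using sylow_thm[OF assms is_group _ finite_carrier] by blast
qed

text \<open>Sylow subgroups are multiplied together one prime at a time; coprime orders make the
  factors commute, so each product is a subgroup.\<close>

lemma hall_subgroup_exists:
  assumes "S \<subseteq> prime_factors (order G)"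
  shows "\<exists>H. subgroup H G \<and> card H = (\<Prod>q\<in>S. sylow_card q)"
proof -
  have "finite S" using assms finite_subset by blast
  thus ?thesis using assms
  proof (induction S rule: finite_induct)
    case empty
    show ?case using triv_subgroup by (intro exI[of _ "{\<one>}"]) simp
  next
    case (insert q S)
    then obtain H where H: "subgroup H G" "card H = (\<Prod>q\<in>S. sylow_card q)" by auto
    obtain P where P: "subgroup P G" "card P = sylow_card q"
      using sylow_subgroup_exists[of q] insert.prems by auto
    have cop: "coprime (card P) (card H)"
      unfolding P H using coprime_sylow_card_prod[of S q] insert by auto
    show ?case
      using coprime_subgroups_set_mult[OF P(1) H(1) cop] card_set_mult_coprime[OF P(1) H(1) cop] insert.hyps P H
      by (intro exI[of _ "P <#> H"]) simp
  qed
qed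

text \<open>Generators of the Sylow subgroups commute and have coprime orders, so their product has
  the order of the group.\<close>

lemma cyclic_sylow_imp_cyclic:
  assumes cyc: "\<And>q P. q \<in> prime_factors (order G) \<Longrightarrow> subgroup P G \<Longrightarrow> card P = sylow_card q
      \<Longrightarrow> cyclic_group (G\<lparr>carrier := P\<rparr>)"
  shows "cyclic_group G"
proof -
  have "\<exists>x\<in>carrier G. ord x = (\<Prod>q\<in>S. sylow_card q)" if "S \<subseteq> prime_factors (order G)" for S
  proof -
    have "finite S" using that finite_subset by blast
    thus ?thesis using that
    proof (induction S rule: finite_induct)
      case empty
      show ?case by (intro bexI[of _ \<one>]) auto
    next
      case (insert q S)
      then obtain x where x: "x \<in> carrier G" "ord x = (\<Prod>q\<in>S. sylow_card q)" by auto
      obtain P where P: "subgroup P G" "card P = sylow_card q"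
        using sylow_subgroup_exists[of q] insert.prems by auto
      obtain y where y: "y \<in> carrier G" "P = generate G {y}"
        using cyclic_subgroup_generator[OF P(1) cyc[OF _ P]] insert.prems by auto
      have oy: "ord y = sylow_card q" using generate_pow_card[OF y(1)] y(2) P(2) by simp
      have cop: "coprime (ord y) (ord x)"
        unfolding oy x using coprime_sylow_card_prod[of S q] insert by auto
      have "y \<otimes> x = x \<otimes> y"
        by (rule nilpotent_coprime_commute[OF nilpotent y(1) x(1) pow_ord_eq_1[OF y(1)] pow_ord_eq_1[OF x(1)] cop])
      hence "ord (y \<otimes> x) = (\<Prod>q\<in>insert q S. sylow_card q)"
        using ord_mult_coprime[OF y(1) x(1) _ cop] oy x insert.hyps by simp
      thus ?case using x y by blast
    qed
  qed
  then obtain x where "x \<in> carrier G" "ord x = (\<Prod>q\<in>prime_factors (order G). sylow_card q)" by blast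
  thus ?thesis
    using cyclic_groupI_ord[OF finite_carrier] prime_factorization_nat[of "order G"] order_pos by simp
qed

lemma sylow_complement:
  assumes q: "q \<in> prime_factors (order G)" and P: "subgroup P G" "card P = sylow_card q"
  obtains Q where "subgroup Q G" "coprime (card P) (card Q)" "P <#> Q = carrier G"
proof -
  let ?S = "prime_factors (order G) - {q}"
  obtain Q where Q: "subgroup Q G" "card Q = (\<Prod>r\<in>?S. sylow_card r)"
    using hall_subgroup_exists[of ?S] by blast
  have cop: "coprime (card P) (card Q)"
    unfolding P Q using coprime_sylow_card_prod[of ?S q] q by auto
  have "order G = (\<Prod>r\<in>prime_factors (order G). sylow_card r)"
    using prime_factorization_nat order_pos by blast
  also have "\<dots> = sylow_card q * (\<Prod>r\<in>?S. sylow_card r)"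
    by (rule prod.remove) (use q in auto)
  finally have "card (P <#> Q) = card (carrier G)"
    using card_set_mult_coprime[OF P(1) Q(1) cop] P Q by (simp add: order_def)
  hence "P <#> Q = carrier G"
    using card_subset_eq[OF finite_carrier] subgroup.subset[OF coprime_subgroups_set_mult[OF P(1) Q(1) cop]] by blast
  thus ?thesis using that Q cop by blast
qed

text \<open>The projection onto the Sylow factor is a power map \<open>g \<mapsto> g\<^sup>m\<close> with
  \<open>m \<equiv> 1\<close> modulo \<open>card P\<close> and \<open>m \<equiv> 0\<close> modulo the order of the complement.\<close>
lemma sylow_projection:
  assumes q: "q \<in> prime_factors (order G)" and P: "subgroup P G" "card P = sylow_card q"
  obtains h where "h \<in> hom G (G\<lparr>carrier := P\<rparr>)" "\<And>x. x \<in> carrier G \<Longrightarrow> x [^] card P = \<one> \<Longrightarrow> h x = x"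
proof -
  obtain Q where Q: "subgroup Q G" "coprime (card P) (card Q)" "P <#> Q = carrier G"
    using sylow_complement[OF assms] .
  note Pc = subgroup.mem_carrier[OF P(1)] and Qc = subgroup.mem_carrier[OF Q(1)]
  have comm: "x \<otimes> y = y \<otimes> x" if "x \<in> P" "y \<in> Q" for x y
    using coprime_subgroups_commute[OF P(1) Q(1,2)] that by blast
  have q1: "q > 1" "multiplicity q (order G) > 0"
    using q prime_gt_1_nat by (auto simp: prime_factors_multiplicity)
  hence "card P \<noteq> 1" using P(2) by simp
  then obtain u v where uv: "card Q * u = card P * v + 1"
    using coprime_bezout_strong[of "card Q" "card P"] Q(2) by (auto simp: coprime_commute)
  define m where "m = card Q * u"
  have Pm: "x [^] m = x" if "x \<in> P" for x
  proof -
    have "x [^] m = (x [^] card P) [^] v \<otimes> x"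
      using Pc[OF that] uv unfolding m_def by (simp add: nat_pow_pow)
    thus ?thesis using subgroup_pow_card[OF P(1) that] Pc[OF that] by simp
  qed
  have Qm: "y [^] m = \<one>" if "y \<in> Q" for y
  proof -
    have "y [^] m = (y [^] card Q) [^] u" using Qc[OF that] by (simp add: m_def nat_pow_pow)
    thus ?thesis using subgroup_pow_card[OF Q(1) that] by simp
  qed
  have prod: "(x \<otimes> y) [^] m = x" if "x \<in> P" "y \<in> Q" for x y
    using pow_mult_distrib[OF comm[OF that] Pc[OF that(1)] Qc[OF that(2)]] Pm Qm that Pc by simp
  have dec: "\<exists>x\<in>P. \<exists>y\<in>Q. g = x \<otimes> y" if "g \<in> carrier G" for g
    using that unfolding Q(3)[symmetric] by (auto simp: set_mult_def)
  show ?thesis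
  proof
    \<comment> \<open>The power map is multiplicative although the group need not be abelian: it
      sends a product of \<open>x\<close> in \<open>P\<close> and \<open>y\<close> in
      \<open>Q\<close> to \<open>x\<close>, and \<open>P\<close> commutes with
      \<open>Q\<close>.\<close>
    show "(\<lambda>g. g [^] m) \<in> hom G (G\<lparr>carrier := P\<rparr>)"
    proof (rule homI)
      fix g assume "g \<in> carrier G"
      thus "g [^] m \<in> carrier (G\<lparr>carrier := P\<rparr>)" using dec prod by fastforce
      fix g' assume "g' \<in> carrier G"
      with \<open>g \<in> carrier G\<close> obtain x y x' y' where xy: "x \<in> P" "y \<in> Q" "g = x \<otimes> y" "x' \<in> P" "y' \<in> Q" "g' = x' \<otimes> y'"
        using dec by metis
      have "g \<otimes> g' = x \<otimes> ((y \<otimes> x') \<otimes> y')" using xy Pc Qc by (simp add: m_assoc)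
      also have "y \<otimes> x' = x' \<otimes> y" using comm[of x' y] xy by simp
      also have "x \<otimes> ((x' \<otimes> y) \<otimes> y') = (x \<otimes> x') \<otimes> (y \<otimes> y')" using xy Pc Qc by (simp add: m_assoc)
      finally have "(g \<otimes> g') [^] m = x \<otimes> x'"
        using prod xy subgroup.m_closed[OF P(1)] subgroup.m_closed[OF Q(1)] by simp
      thus "(g \<otimes> g') [^] m = g [^] m \<otimes>\<^bsub>G\<lparr>carrier := P\<rparr>\<^esub> g' [^] m" using prod xy by simp
    qed
    fix g assume g: "g \<in> carrier G" "g [^] card P = \<one>"
    obtain x y where xy: "x \<in> P" "y \<in> Q" "g = x \<otimes> y" using dec g by blast
    have "x [^] card P \<otimes> y [^] card P = \<one>"
      using g(2) pow_mult_distrib[OF comm[OF xy(1,2)] Pc[OF xy(1)] Qc[OF xy(2)]] xy by simp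
    hence "y [^] card P = \<one>" using subgroup_pow_card[OF P(1) xy(1)] Qc[OF xy(2)] by simp
    hence "y = \<one>"
      using pow_coprime_eq_one[OF Qc[OF xy(2)] _ subgroup_pow_card[OF Q(1) xy(2)] Q(2)] by blast
    thus "g [^] m = g" using prod[OF xy(1,2)] xy Pc by simp
  qed
qed

text \<open>For class at most 1 any noncyclic Sylow subgroup works, its exponent being at least 2.
  Otherwise the prime is read off from an element of prime order in the last nontrivial term of the
  lower central series.\<close>

lemma noncyclic_large_sylow:
  assumes nc: "\<not> cyclic_group G"
  obtains q P where "q \<in> prime_factors (order G)" "subgroup P G" "card P = sylow_card q"
    "\<not> cyclic_group (G\<lparr>carrier := P\<rparr>)" "nilpotency_class G < multiplicity q (order G)"
proof -
  have pg: "nilpotent_p_group (G\<lparr>carrier := P\<rparr>) q (multiplicity q (order G))"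
    if "q \<in> prime_factors (order G)" "subgroup P G" "card P = sylow_card q" for q P
  proof -
    interpret P: group "G\<lparr>carrier := P\<rparr>" using that(2) by (rule subgroup_imp_group)
    show ?thesis
      by unfold_locales (use that nilpotent_subgroup[OF nilpotent] in \<open>auto simp: order_def\<close>)
  qed
  let ?c = "nilpotency_class G"
  show ?thesis
  proof (cases "?c \<le> 1")
    case True
    obtain q P where qP: "q \<in> prime_factors (order G)" "subgroup P G" "card P = sylow_card q"
      "\<not> cyclic_group (G\<lparr>carrier := P\<rparr>)"
      using cyclic_sylow_imp_cyclic nc by blast
    have "2 \<le> multiplicity q (order G)"
      using nilpotent_p_group.noncyclic_exponent_ge_2[OF pg[OF qP(1-3)] qP(4)] .
    thus ?thesis using that qP True by simp
  next
    case False
    have "lower_central G (?c - 1) \<noteq> {\<one>}"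
      using not_less_Least[of "?c - 1" "\<lambda>c. lower_central G c = {\<one>}"] False
      unfolding nilpotency_class_def by simp
    then obtain w where w: "w \<in> lower_central G (?c - 1)" "w \<noteq> \<one>"
      using subgroup.one_closed[OF lower_central_is_subgroup] by blast
    have wc: "w \<in> carrier G" using w lower_central_subset_carrier by blast
    have "ord w \<noteq> 1" using w wc ord_eq_1 by blast
    then obtain q where q: "Factorial_Ring.prime q" "q dvd ord w" using prime_factor_nat by blast
    then obtain r where r: "ord w = q * r" by blast
    have ow: "ord w dvd order G" using ord_dvd_group_order wc by blast
    have qp: "q \<in> prime_factors (order G)"
      using q ow order_pos by (auto simp: prime_factors_dvd dest: dvd_trans)
    obtain P where P: "subgroup P G" "card P = sylow_card q" using sylow_subgroup_exists q(1) by blast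
    \<comment> \<open>As \<open>ord w = q * r\<close>, this power has order \<open>q\<close>; hence
      \<open>card P\<close> kills it and the projection onto \<open>P\<close> fixes it.\<close>
    define z where "z = w [^] r"
    have zc: "z \<in> carrier G" using wc by (simp add: z_def)
    have z: "z \<in> lower_central G (?c - 1)"
      unfolding z_def by (induction r)
        (use w lower_central_is_subgroup in \<open>simp_all add: subgroup.one_closed subgroup.m_closed\<close>)
    have "z \<noteq> \<one>"
    proof
      assume "z = \<one>"
      hence "q * r dvd r" using pow_eq_id[OF wc, of r] r by (simp add: z_def)
      moreover have "ord w > 0" using ow order_pos by (auto intro: Nat.gr0I)
      ultimately show False using r q prime_gt_1_nat[OF q(1)] by (auto dest: dvd_imp_le)
    qed
    have "z [^] q = w [^] ord w" using wc by (simp add: z_def nat_pow_pow r mult.commute)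
    hence "z [^] q = \<one>" using wc by simp
    moreover have "multiplicity q (order G) > 0" using qp by (simp add: prime_factors_multiplicity)
    hence "card P = q * q ^ (multiplicity q (order G) - 1)" unfolding P(2) by (simp add: power_eq_if)
    hence "z [^] card P = (z [^] q) [^] (q ^ (multiplicity q (order G) - 1))"
      using nat_pow_pow[OF zc] by metis
    ultimately have zP: "z [^] card P = \<one>" by simp
    interpret P: nilpotent_p_group "G\<lparr>carrier := P\<rparr>" q "multiplicity q (order G)" by (rule pg[OF qp P])
    obtain h where h: "h \<in> hom G (G\<lparr>carrier := P\<rparr>)" "\<And>x. x \<in> carrier G \<Longrightarrow> x [^] card P = \<one> \<Longrightarrow> h x = x"
      using sylow_projection[OF qp P] by blast
    have "z \<in> lower_central (G\<lparr>carrier := P\<rparr>) (?c - 1)"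
      using hom_image_lower_central[OF P.is_group h(1), of "?c - 1"] z h(2)[OF zc zP] by force
    hence nontriv: "\<not> lower_central (G\<lparr>carrier := P\<rparr>) (?c - 1) \<subseteq> {\<one>}" using \<open>z \<noteq> \<one>\<close> by blast
    \<comment> \<open>A cyclic \<open>P\<close> would be abelian, but its series is still nontrivial
      at index \<open>?c - 1 \<ge> 1\<close>.\<close>
    have ncP: "\<not> cyclic_group (G\<lparr>carrier := P\<rparr>)"
    proof
      assume "cyclic_group (G\<lparr>carrier := P\<rparr>)"
      then interpret cP: comm_group "G\<lparr>carrier := P\<rparr>" by (rule P.cyclic_imp_abelian_group)
      have "lower_central (G\<lparr>carrier := P\<rparr>) 1 \<subseteq> {\<one>\<^bsub>G\<lparr>carrier := P\<rparr>\<^esub>}"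
        unfolding One_nat_def lower_central.simps
      proof (rule P.commutator_subgroup_subset[OF P.triv_subgroup])
        fix x y assume xy: "x \<in> carrier (G\<lparr>carrier := P\<rparr>)" "y \<in> carrier (G\<lparr>carrier := P\<rparr>)"
        hence "P.commutator x y = \<one>\<^bsub>G\<lparr>carrier := P\<rparr>\<^esub>"
          using P.commutator_eq_one_iff cP.m_comm by blast
        thus "P.commutator x y \<in> {\<one>\<^bsub>G\<lparr>carrier := P\<rparr>\<^esub>}" by blast
      qed
      moreover have "lower_central (G\<lparr>carrier := P\<rparr>) (?c - 1) \<subseteq> lower_central (G\<lparr>carrier := P\<rparr>) 1"
        by (rule P.lower_central_antimono) (use False in simp)
      ultimately show False using nontriv by auto
    qed
    have "lower_central (G\<lparr>carrier := P\<rparr>) (multiplicity q (order G) - 1) = {\<one>}"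
      using P.noncyclic_lower_central_trivial[OF ncP] by simp
    hence "\<not> multiplicity q (order G) - 1 \<le> ?c - 1"
      using P.lower_central_antimono nontriv by metis
    thus ?thesis using that[OF qp P ncP] False by linarith
  qed
qed

end

section \<open>Counting conjugacy classes of subgroups\<close>

context group
begin

lemma conj_class_self:
  assumes "H \<subseteq> carrier G"
  shows "H \<in> subgroup_conj_class G H"
proof -
  have "\<one> <# H #> inv \<one> = H"
    using assms by (auto simp: l_coset_def r_coset_def subset_iff)
  thus ?thesis unfolding subgroup_conj_class_def using one_closed by blast
qed

lemma conj_class_memD:
  assumes "K \<in> subgroup_conj_class G H"
  obtains g where "g \<in> carrier G" "K = (\<lambda>h. g \<otimes> h \<otimes> inv g) ` H"
proof -
  obtain g where g: "g \<in> carrier G" "K = g <# H #> inv g"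
    using assms unfolding subgroup_conj_class_def by blast
  have "g <# H #> inv g = (\<lambda>h. g \<otimes> h \<otimes> inv g) ` H"
    unfolding l_coset_def r_coset_def by blast
  thus ?thesis using that g by metis
qed

lemma card_conj:
  assumes "g \<in> carrier G" "H \<subseteq> carrier G"
  shows "card ((\<lambda>h. g \<otimes> h \<otimes> inv g) ` H) = card H"
proof (rule card_image, rule inj_onI)
  fix x y assume "x \<in> H" "y \<in> H" and eq: "g \<otimes> x \<otimes> inv g = g \<otimes> y \<otimes> inv g"
  hence "x \<in> carrier G" "y \<in> carrier G" using assms(2) by auto
  thus "x = y" using eq assms(1) by simp
qed

lemma conj_pow:
  assumes "g \<in> carrier G" "x \<in> carrier G"
  shows "(g \<otimes> x \<otimes> inv g) [^] (n::nat) = g \<otimes> x [^] n \<otimes> inv g"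
proof (induction n)
  case (Suc n)
  have "(g \<otimes> x \<otimes> inv g) [^] Suc n = (g \<otimes> x [^] n \<otimes> inv g) \<otimes> (g \<otimes> x \<otimes> inv g)"
    using Suc by simp
  also have "\<dots> = g \<otimes> x [^] Suc n \<otimes> inv g" using assms by (simp add: group_word_simps)
  finally show ?case .
qed (use assms in simp)

lemma conj_eq_one_iff:
  assumes "g \<in> carrier G" "x \<in> carrier G"
  shows "g \<otimes> x \<otimes> inv g = \<one> \<longleftrightarrow> x = \<one>"
proof
  assume "g \<otimes> x \<otimes> inv g = \<one>"
  hence "inv g \<otimes> (g \<otimes> x \<otimes> inv g) \<otimes> g = \<one>" using assms by simp
  thus "x = \<one>" using assms by (simp add: group_word_simps)
qed (use assms in simp)

end

context finite_nilpotent_group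
begin

text \<open>Unique factorization: a prime of \<open>S\<close> divides the right-hand side, does not
  divide \<open>p ^ j\<close>, and so divides a factor indexed by \<open>T\<close>. Used in both
  directions, it recovers the set of primes from the order.\<close>

lemma card_prod_sylow_subset:
  assumes S: "S \<subseteq> prime_factors (order G) - {p}" and T: "T \<subseteq> prime_factors (order G) - {p}"
    and p: "Factorial_Ring.prime p"
    and eq: "p ^ i * (\<Prod>q\<in>S. sylow_card q) = p ^ j * (\<Prod>q\<in>T. sylow_card q)"
  shows "S \<subseteq> T"
proof
  fix q assume q: "q \<in> S"
  have fin: "finite S" "finite T" using S T finite_subset by blast+
  have qp: "q \<in> prime_factors (order G)" "q \<noteq> p" using q S by auto
  have pq: "Factorial_Ring.prime q" using qp by auto
  have "q dvd sylow_card q" using qp by (simp add: prime_factors_multiplicity)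
  also have "\<dots> dvd (\<Prod>q\<in>S. sylow_card q)" using fin(1) q by (rule dvd_prodI)
  also have "\<dots> dvd p ^ j * (\<Prod>q\<in>T. sylow_card q)" using eq by (metis dvd_triv_right)
  finally have "q dvd p ^ j \<or> q dvd (\<Prod>q\<in>T. sylow_card q)" using pq prime_dvd_multD by blast
  moreover have "\<not> q dvd p ^ j" using pq p qp by (metis prime_dvd_power primes_dvd_imp_eq)
  ultimately have "q dvd (\<Prod>q\<in>T. sylow_card q)" by simp
  hence "\<exists>r\<in>T. q dvd sylow_card r" by (simp only: prime_dvd_prod_iff[OF fin(2) pq])
  then obtain r where r: "r \<in> T" "q dvd sylow_card r" ..
  hence "q dvd r" using pq prime_dvd_power by blast
  moreover have "Factorial_Ring.prime r" using r T by auto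
  ultimately have "q = r" using pq primes_dvd_imp_eq by blast
  thus "q \<in> T" using r by simp
qed

text \<open>The complement centralizes \<open>P\<close>, so conjugation by any element acts on
  \<open>A\<close> like conjugation by its \<open>P\<close>-component.\<close>

lemma normal_in_sylow_imp_normal:
  assumes q: "q \<in> prime_factors (order G)" and P: "subgroup P G" "card P = sylow_card q"
    and A: "A \<lhd> (G\<lparr>carrier := P\<rparr>)"
  shows "A \<lhd> G"
  unfolding normal_inv_iff
proof (intro conjI ballI)
  interpret P: group "G\<lparr>carrier := P\<rparr>" using P(1) by (rule subgroup_imp_group)
  obtain Q where Q: "subgroup Q G" "coprime (card P) (card Q)" "P <#> Q = carrier G"
    using sylow_complement[OF q P] .
  have sA: "subgroup A (G\<lparr>carrier := P\<rparr>)" using A by (rule normal_imp_subgroup)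
  show "subgroup A G" using incl_subgroup[OF P(1) sA] .
  have AP: "A \<subseteq> P" using subgroup.subset[OF sA] by simp
  fix g z assume g: "g \<in> carrier G" and z: "z \<in> A"
  obtain x y where xy: "x \<in> P" "y \<in> Q" "g = x \<otimes> y"
    using g unfolding Q(3)[symmetric] by (auto simp: set_mult_def)
  have c: "x \<in> carrier G" "y \<in> carrier G" "z \<in> carrier G"
    using subgroup.mem_carrier[OF P(1)] subgroup.mem_carrier[OF Q(1)] xy z AP by auto
  have yz: "y \<otimes> z = z \<otimes> y"
    using coprime_subgroups_commute[OF P(1) Q(1,2), of z y] xy z AP by auto
  have "g \<otimes> z \<otimes> inv g = x \<otimes> ((y \<otimes> z) \<otimes> inv y) \<otimes> inv x"
    using xy c by (simp add: group_word_simps)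
  also have "\<dots> = x \<otimes> z \<otimes> inv x" unfolding yz using c by (simp add: group_word_simps)
  finally have eq: "g \<otimes> z \<otimes> inv g = x \<otimes> z \<otimes> inv x" .
  have "x \<otimes> z \<otimes> inv\<^bsub>G\<lparr>carrier := P\<rparr>\<^esub> x \<in> A"
    using A xy z unfolding P.normal_inv_iff by simp
  thus "g \<otimes> z \<otimes> inv g \<in> A" using eq m_inv_consistent[OF P(1) xy(1)] by simp
qed

text \<open>The work is injectivity of \<open>f\<close>: the order of the product determines the set
  of primes and the order of \<open>A\<close>, and a conjugation between two products already
  conjugates their parts inside \<open>P\<close>.\<close>

lemma D_count_ge:
  assumes q: "q \<in> prime_factors (order G)" and P: "subgroup P G" "card P = sylow_card q"
    and nc: "\<not> cyclic_group (G\<lparr>carrier := P\<rparr>)"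
  shows "multiplicity q (order G) * 2 ^ card (prime_factors (order G)) \<le> D_count G + 2"
proof -
  let ?a = "multiplicity q (order G)" and ?\<pi> = "prime_factors (order G) - {q}"
  interpret P: group "G\<lparr>carrier := P\<rparr>" using P(1) by (rule subgroup_imp_group)
  interpret P: nilpotent_p_group "G\<lparr>carrier := P\<rparr>" q ?a
    by unfold_locales (use q P nilpotent_subgroup[OF nilpotent] in \<open>auto simp: order_def\<close>)
  have pq: "Factorial_Ring.prime q" using q by auto
  obtain F where F: "finite F" "card F = 2 * ?a" "\<And>A. A \<in> F \<Longrightarrow> subgroup A (G\<lparr>carrier := P\<rparr>)"
    "\<And>A B. A \<in> F \<Longrightarrow> B \<in> F \<Longrightarrow> card A = card B \<Longrightarrow> A \<noteq> B \<Longrightarrow>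
       A \<lhd> G\<lparr>carrier := P\<rparr> \<or> B \<lhd> G\<lparr>carrier := P\<rparr>"
    using P.noncyclic_nonconjugate_family[OF nc] by blast
  have "\<forall>S\<in>Pow ?\<pi>. \<exists>H. subgroup H G \<and> card H = (\<Prod>q\<in>S. sylow_card q)"
    using hall_subgroup_exists by auto
  from bchoice[OF this] obtain H where H: "\<And>S. S \<subseteq> ?\<pi> \<Longrightarrow> subgroup (H S) G"
    "\<And>S. S \<subseteq> ?\<pi> \<Longrightarrow> card (H S) = (\<Prod>q\<in>S. sylow_card q)"
    by auto
  have copS: "coprime (card P) (card (H S))" if "S \<subseteq> ?\<pi>" for S
    unfolding P(2) H(2)[OF that] by (rule coprime_sylow_card_prod) (use q that in auto)
  have FG: "subgroup A G" "A \<subseteq> P" "finite A" if "A \<in> F" for A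
    using incl_subgroup[OF P(1) F(3)[OF that]] subgroup.subset[OF F(3)[OF that]]
      P.finite_subgroup[OF F(3)[OF that]] by auto
  have Fcard: "\<exists>i. card A = q ^ i" if "A \<in> F" for A
    by (rule P.subgroup_card[OF F(3)[OF that]]) (rule exI)
  have cop: "coprime (card A) (card (H S))" if A: "A \<in> F" and S: "S \<subseteq> ?\<pi>" for A S
  proof -
    obtain i where i: "card A = q ^ i" using Fcard[OF A] by blast
    have "coprime q (card (H S))"
      using copS[OF S] q unfolding P(2) by (auto simp: prime_factors_multiplicity)
    thus ?thesis unfolding i by simp
  qed
  define f where "f = (\<lambda>(A, S). subgroup_conj_class G (A <#> H S))"
  let ?I = "F \<times> Pow ?\<pi>"
  have subAS: "subgroup (A <#> H S) G" if "A \<in> F" "S \<subseteq> ?\<pi>" for A S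
    using coprime_subgroups_set_mult[OF FG(1)[OF that(1)] H(1)[OF that(2)] cop[OF that]] .
  have inj: "inj_on f ?I"
  proof (rule inj_onI)
    fix s t assume st: "s \<in> ?I" "t \<in> ?I" "f s = f t"
    obtain A S B T where AS: "s = (A, S)" "t = (B, T)" by (cases s, cases t)
    have mem: "A \<in> F" "B \<in> F" "S \<subseteq> ?\<pi>" "T \<subseteq> ?\<pi>" using st AS by auto
    note Ac = subgroup.mem_carrier[OF FG(1)[OF mem(1)]] and Bc = subgroup.mem_carrier[OF FG(1)[OF mem(2)]]
      and HTc = subgroup.mem_carrier[OF H(1)[OF mem(4)]]
    have "A <#> H S \<in> subgroup_conj_class G (B <#> H T)"
      using conj_class_self[OF subgroup.subset[OF subAS[OF mem(1,3)]]] st(3) unfolding AS f_def by simp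
    then obtain g where g: "g \<in> carrier G" and geq: "A <#> H S = (\<lambda>h. g \<otimes> h \<otimes> inv g) ` (B <#> H T)"
      by (rule conj_class_memD)
    have "card (A <#> H S) = card (B <#> H T)"
      unfolding geq using card_conj[OF g subgroup.subset[OF subAS[OF mem(2,4)]]] .
    hence ceq: "card A * card (H S) = card B * card (H T)"
      using card_set_mult_coprime[OF FG(1)[OF mem(1)] H(1)[OF mem(3)] cop[OF mem(1,3)]]
        card_set_mult_coprime[OF FG(1)[OF mem(2)] H(1)[OF mem(4)] cop[OF mem(2,4)]] by simp
    obtain i j where ij: "card A = q ^ i" "card B = q ^ j" using Fcard mem by blast
    have prodeq: "q ^ i * (\<Prod>q\<in>S. sylow_card q) = q ^ j * (\<Prod>q\<in>T. sylow_card q)"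
      using ceq unfolding ij H(2)[OF mem(3)] H(2)[OF mem(4)] .
    have ST: "S = T"
      using card_prod_sylow_subset[OF mem(3,4) pq prodeq] card_prod_sylow_subset[OF mem(4,3) pq prodeq[symmetric]] by blast
    have "card (H T) > 0"
      using subgroup.finite_imp_card_positive[OF H(1)[OF mem(4)] finite_carrier] .
    hence cAB: "card A = card B" using ceq ST by simp
    \<comment> \<open>Raising to the power \<open>card P\<close> kills \<open>x\<close> and
      \<open>b\<close>, hence also \<open>h\<close>; but \<open>h\<close> has order prime to
      \<open>card P\<close>, so it is trivial.\<close>
    have conj: "\<exists>b\<in>B. x = g \<otimes> b \<otimes> inv g" if x: "x \<in> A" for x
    proof -
      have "x \<otimes> \<one> \<in> A <#> H S"
        using x subgroup.one_closed[OF H(1)[OF mem(3)]] unfolding set_mult_def by blast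
      hence "x \<in> A <#> H S" using Ac[OF x] by simp
      then obtain b h where bh: "b \<in> B" "h \<in> H T" "x = g \<otimes> (b \<otimes> h) \<otimes> inv g"
        unfolding geq by (auto simp: set_mult_def)
      have bc: "b \<in> carrier G" and hc: "h \<in> carrier G" using bh Bc HTc by auto
      have comm: "b \<otimes> h = h \<otimes> b"
        using coprime_subgroups_commute[OF FG(1)[OF mem(2)] H(1)[OF mem(4)] cop[OF mem(2,4)]] bh by blast
      have cl: "(b \<otimes> h) [^] card P \<in> carrier G" using bc hc by simp
      have "g \<otimes> (b \<otimes> h) [^] card P \<otimes> inv g = x [^] card P"
        using conj_pow[OF g, of "b \<otimes> h"] bh bc hc by simp
      also have "\<dots> = \<one>" using subgroup_pow_card[OF P(1)] FG(2)[OF mem(1)] x by blast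
      finally have "(b \<otimes> h) [^] card P = \<one>" by (rule iffD1[OF conj_eq_one_iff[OF g cl]])
      hence "b [^] card P \<otimes> h [^] card P = \<one>" using pow_mult_distrib[OF comm bc hc] by simp
      moreover have "b [^] card P = \<one>" using subgroup_pow_card[OF P(1)] FG(2)[OF mem(2)] bh by blast
      ultimately have "h [^] card P = \<one>" using hc by simp
      hence "h = \<one>"
        using pow_coprime_eq_one[OF hc _ subgroup_pow_card[OF H(1)[OF mem(4)] bh(2)] copS[OF mem(4)]] by blast
      thus ?thesis using bh bc by auto
    qed
    have "A = B"
    proof (rule ccontr)
      assume ne: "A \<noteq> B"
      hence "A \<lhd> G \<or> B \<lhd> G"
        using F(4)[OF mem(1,2) cAB] normal_in_sylow_imp_normal[OF q P] by blast
      \<comment> \<open>By \<open>conj\<close>, \<open>A\<close> lies in the conjugate of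
        \<open>B\<close> by \<open>g\<close>. If \<open>B\<close> is normal this is the claim; if
        \<open>A\<close> is normal, conjugating \<open>x\<close> by \<open>g\<close> first stays in
        \<open>A\<close> and cancels \<open>g\<close>.\<close>
      hence "A \<subseteq> B"
      proof
        assume nB: "B \<lhd> G"
        show "A \<subseteq> B"
        proof
          fix x assume "x \<in> A"
          then obtain b where "b \<in> B" "x = g \<otimes> b \<otimes> inv g" using conj by blast
          thus "x \<in> B" using nB g unfolding normal_inv_iff by blast
        qed
      next
        assume nA: "A \<lhd> G"
        show "A \<subseteq> B"
        proof
          fix x assume x: "x \<in> A"
          have "g \<otimes> x \<otimes> inv g \<in> A" using nA g x unfolding normal_inv_iff by blast
          then obtain b where b: "b \<in> B" "g \<otimes> x \<otimes> inv g = g \<otimes> b \<otimes> inv g" using conj by blast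
          hence "x = b" using g Ac[OF x] Bc[OF b(1)] by simp
          thus "x \<in> B" using b by simp
        qed
      qed
      thus False using card_subset_eq[OF FG(3)[OF mem(2)] _ cAB] ne by blast
    qed
    thus "s = t" using AS ST by simp
  qed
  let ?D = "{subgroup_conj_class G H | H. subgroup H G \<and> H \<noteq> {\<one>} \<and> normalizer G H \<noteq> H}"
  \<comment> \<open>Finiteness has to be secured because \<open>card\<close> of an infinite set is
    0.\<close>
  have "?D \<subseteq> subgroup_conj_class G ` Pow (carrier G)"
  proof
    fix C assume "C \<in> ?D"
    then obtain K where "subgroup K G" "C = subgroup_conj_class G K" by blast
    thus "C \<in> subgroup_conj_class G ` Pow (carrier G)" using subgroup.subset[of K G] by simp
  qed
  hence finD: "finite ?D" by (rule finite_subset) (use finite_carrier in simp)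
  \<comment> \<open>The summand 2 in the claim pays for the trivial subgroup, excluded by
    definition, and the whole group, which is its own normalizer.\<close>
  have "f ` ?I \<subseteq> ?D \<union> {subgroup_conj_class G {\<one>}, subgroup_conj_class G (carrier G)}"
  proof
    fix C assume "C \<in> f ` ?I"
    then obtain A S where AS: "A \<in> F" "S \<subseteq> ?\<pi>" "C = subgroup_conj_class G (A <#> H S)"
      unfolding f_def by auto
    show "C \<in> ?D \<union> {subgroup_conj_class G {\<one>}, subgroup_conj_class G (carrier G)}"
    proof (cases "A <#> H S = {\<one>} \<or> A <#> H S = carrier G")
      case False
      hence "normalizer G (A <#> H S) \<noteq> A <#> H S"
        using nilpotent_normalizer_neq[OF nilpotent subAS[OF AS(1,2)]] by blast
      thus ?thesis using False subAS[OF AS(1,2)] AS(3) by blast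
    qed (use AS in auto)
  qed
  hence "card (f ` ?I) \<le> card (?D \<union> {subgroup_conj_class G {\<one>}, subgroup_conj_class G (carrier G)})"
    using finD by (intro card_mono) auto
  also have "\<dots> \<le> card ?D + card {subgroup_conj_class G {\<one>}, subgroup_conj_class G (carrier G)}"
    by (rule card_Un_le)
  also have "\<dots> \<le> card ?D + 2" using card_insert_le_m1[of 2] by (simp add: card_insert_if)
  finally have "card (f ` ?I) \<le> D_count G + 2" unfolding D_count_def .
  moreover have "card (f ` ?I) = 2 * ?a * 2 ^ card ?\<pi>"
    using card_image[OF inj] F(2) by (simp add: card_cartesian_product card_Pow)
  moreover have "card (prime_factors (order G)) = Suc (card ?\<pi>)"
    using q by (metis card_Suc_Diff1 finite_set_mset)
  ultimately show ?thesis by simp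
qed

lemma lower_central_nilpotency_class: "lower_central G (nilpotency_class G) = {\<one>}"
proof -
  obtain c where "lower_central G c = {\<one>}" using nilpotent nilpotent_group_def by metis
  thus ?thesis unfolding nilpotency_class_def by (rule LeastI)
qed

text \<open>If the class were below \<open>2 ^ d\<close> with \<open>d\<close> one less than the
  derived length, the \<open>d\<close>-th derived subgroup would lie in a trivial term, against
  minimality.\<close>

lemma derived_length_le:
  assumes "derived_length G > 0"
  shows "2 ^ (derived_length G - 1) \<le> nilpotency_class G"
proof (rule ccontr)
  let ?d = "derived_length G - 1"
  assume "\<not> 2 ^ ?d \<le> nilpotency_class G"
  hence "nilpotency_class G \<le> 2 ^ ?d - 1" by simp
  hence "(derived G ^^ ?d) (carrier G) \<subseteq> {\<one>}"
    using derived_pow_subset_lower_central[of ?d] lower_central_antimono lower_central_nilpotency_class by blast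
  moreover have "\<one> \<in> (derived G ^^ ?d) (carrier G)"
    using subgroup.one_closed exp_of_derived_is_subgroup[OF subgroup_self] by blast
  ultimately have "(derived G ^^ ?d) (carrier G) = {\<one>}" by blast
  hence "derived_length G \<le> ?d" unfolding derived_length_def by (rule Least_le)
  thus False using assms by simp
qed

end

theorem mainTheorem7:
  fixes G :: "('a, 'b) monoid_scheme" and n k :: nat
  assumes "group G"
    and "finite (carrier G)"
    and "nilpotent_group G"
    and "\<not> cyclic_group G"
    and "card (prime_factors (order G)) = k"
    and "D_count G = n"
  shows "real (nilpotency_class G) \<le> (real n + 2 - 2 ^ k) / 2 ^ k
       \<and> real (derived_length G) \<le> log 2 ((real n + 2 - 2 ^ k) / 2 ^ k) + 1"
proof -
  interpret group G by fact
  interpret finite_nilpotent_group G by unfold_locales fact+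
  let ?c = "nilpotency_class G" and ?r = "(real n + 2 - 2 ^ k) / 2 ^ k"
  obtain q P where "q \<in> prime_factors (order G)" "subgroup P G" "card P = sylow_card q"
    "\<not> cyclic_group (G\<lparr>carrier := P\<rparr>)" and c: "?c < multiplicity q (order G)"
    using noncyclic_large_sylow[OF assms(4)] by blast
  hence "multiplicity q (order G) * 2 ^ k \<le> n + 2" using D_count_ge assms(5,6) by blast
  \<comment> \<open>The strict inequality between class and exponent yields the \<open>2 ^ k\<close>
    subtracted in the bound.\<close>
  moreover have "Suc ?c * 2 ^ k \<le> multiplicity q (order G) * 2 ^ k" using c by (intro mult_right_mono) auto
  ultimately have "Suc ?c * 2 ^ k \<le> n + 2" by simp
  hence "real (Suc ?c * 2 ^ k) \<le> real (n + 2)" by (simp only: of_nat_le_iff)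
  hence class_le: "real ?c \<le> ?r" by (simp add: field_simps)
  \<comment> \<open>Needed for monotonicity of the logarithm; class 0 would mean a trivial, hence
    cyclic, group.\<close>
  have "?c > 0"
  proof (rule ccontr)
    assume "\<not> ?c > 0"
    hence "carrier G = {\<one>\<^bsub>G\<^esub>}" using lower_central_nilpotency_class by simp
    thus False using assms(4) trivial_imp_cyclic_group is_group unfolding trivial_group_def by blast
  qed
  moreover have "real (derived_length G) \<le> log 2 (real ?c) + 1"
  proof (cases "derived_length G > 0")
    case True
    have "real (2 ^ (derived_length G - 1)) \<le> real ?c"
      using derived_length_le[OF True] by (simp only: of_nat_le_iff)
    hence "log 2 (2 ^ (derived_length G - 1)) \<le> log 2 (real ?c)"
      using \<open>?c > 0\<close> by (subst log_le_cancel_iff) auto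
    moreover have "log 2 (2 ^ (derived_length G - 1)) = real (derived_length G - 1)"
      by (rule log_pow_cancel) auto
    ultimately show ?thesis using True by simp
  \<comment> \<open>For derived length 0 the right-hand side is positive, since \<open>log 2\<close>
    of a class at least 1 is nonnegative.\<close>
  qed (use \<open>?c > 0\<close> in simp)
  moreover have "log 2 (real ?c) \<le> log 2 ?r" 
    using class_le \<open>?c > 0\<close> by (subst log_le_cancel_iff) auto
  ultimately show ?thesis using class_le by linarith
qed

end
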